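(* Let $n$ be a positive integer, let $\mathcal{R}_n$ be the dihedral quandle of order $n$, and let $\mathbb{C}\mathcal{R}_n$ be its regular quandle representation over $\mathbb{C}$. Write $\omega_k = e^{2\pi i/k}$, and write $\cong_{\mathcal{R}_n}$ for isomorphism of quandle representations of $\mathcal{R}_n$. Let $\mathbb{C}(\lambda,\mu)$ and $W(\lambda)$ be the one- and two-dimensional quandle representations of $\mathcal{R}_n$ defined in the context. Then $\mathbb{C}\mathcal{R}_n$ decomposes into irreducible quandle subrepresentations as follows (every summand on each right-hand side below is an irreducible quandle representation of $\mathcal{R}_n$, and empty direct sums are zero). (1) If $n \equiv 0 \pmod 4$, then $$\mathbb{C}\mathcal{R}_n \;\cong_{\mathcal{R}_n}\; \mathbb{C}(1,1)^{\oplus 2} \oplus \mathbb{C}(1,-1) \oplus \mathbb{C}(-1,1) \oplus \bigoplus_{s=1}^{n/4-1} W\!\left(\omega_{n/2}^{s}\right)^{\oplus 2}.$$ (2) If $n \equiv 2 \pmod 4$, then $$\mathbb{C}\mathcal{R}_n \;\cong_{\mathcal{R}_n}\; \mathbb{C}(1,1)^{\oplus 2} \oplus \bigoplus_{s=1}^{(n-2)/4} W\!\left(\omega_{n/2}^{s}\right)^{\oplus 2}.$$ (3) If $n$ is odd, then $$\mathbb{C}\mathcal{R}_n \;\cong_{\mathcal{R}_n}\; \mathbb{C}(1,1) \oplus \bigoplus_{s=1}^{(n-1)/2} W\!\left(\omega_{n}^{2s}\right).$$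
   Context: All vector spaces are over $\mathbb{C}$. **Quandles.** A rack is a set $X$ with a binary operation $\triangleright$ such that (i) for all $x,y\in X$ there is a unique $z\in X$ with $y=z\triangleright x$, and (ii) $(x\triangleright y)\triangleright z=(x\triangleright z)\triangleright(y\triangleright z)$ for all $x,y,z\in X$. A quandle is a rack with $x\triangleright x=x$ for all $x$. A quandle homomorphism is a map $f$ with $f(x\triangleright y)=f(x)\triangleright f(y)$. For $x\in X$, $R_x:X\to X$ denotes the bijection $R_x(y)=y\triangleright x$. The inner automorphism group $\mathrm{Inn}(X)$ is the subgroup of the symmetric group on $X$ generated by all $R_x$, $x\in X$. For a group $G$, $\mathrm{Conj}(G)$ is the quandle with underlying set $G$ and operation $x\triangleright y=yxy^{-1}$. **Dihedral quandle.** $\mathcal{R}_n=\{1,2,\ldots,n\}$ (representatives of the residue classes modulo $n$) with operation $x\triangleright y=2y-x \pmod n$. Elements of $\mathcal{R}_n$, and hence subscripts of $R_x$, are read modulo $n$. The group $\mathrm{Inn}(\mathcal{R}_n)$ is generated by $R_1$ and $R_2$. **Quandle representations.** A representation of a finite quandle $X$ on a finite-dimensional complex vector space $V$ is a quandle homomorphism $\rho:X\to\mathrm{Conj}(GL(V))$, $x\mapsto\rho_x$, i.e. $\rho_{x\triangleright y}=\rho_y\rho_x\rho_y^{-1}$ for all $x,y\in X$. A subspace $U\subseteq V$ is a subrepresentation if it is invariant under all $\rho_x$, $x\in X$. The representation $V$ is irreducible if its only subrepresentations are $\{0\}$ and $V$. Two representations $(V,\rho^V)$, $(W,\rho^W)$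 of $X$ are isomorphic, written $V\cong_X W$, if there is a linear isomorphism $\phi:V\to W$ with $\phi\circ\rho^V_x=\rho^W_x\circ\phi$ for all $x\in X$. Direct sums are formed in the usual way: $\rho_x$ acts on $V\oplus W$ as $\rho^V_x\oplus\rho^W_x$. Any group representation $\phi:\mathrm{Inn}(X)\to GL(V)$ induces a quandle representation of $X$ by $x\mapsto\phi(R_x)$. **Regular representation.** For a finite quandle $X$, $\mathbb{C}X$ is the vector space of all functions $X\to\mathbb{C}$ (equivalently, the space with basis $\{e_x\}_{x\in X}$). The regular representation is $\lambda:X\to\mathrm{Conj}(GL(\mathbb{C}X))$, $\lambda_t(f)(x)=f(R_t^{-1}(x))$; equivalently $\lambda_t(e_x)=e_{R_t(x)}=e_{x\triangleright t}$. **The representations $\mathbb{C}(\lambda,\mu)$ and $W(\lambda)$ of $\mathcal{R}_n$.** $\mathbb{C}(\lambda,\mu)$ denotes the one-dimensional group representation of $\mathrm{Inn}(\mathcal{R}_n)$ on which $R_1$ and $R_2$ act by multiplication by the scalars $\lambda$ and $\mu$, respectively. For nonzero $\lambda\in\mathbb{C}$, $W(\lambda)$ denotes the two-dimensional group representation of $\mathrm{Inn}(\mathcal{R}_n)$ for which $$R_1\mapsto\begin{bmatrix}0&1\\1&0\end{bmatrix},\qquad R_2\mapsto\begin{bmatrix}0&\lambda\\ \lambda^{-1}&0\end{bmatrix}.$$ These are used only for values of the parameters for which such a representation of $\mathrm{Inn}(\mathcal{R}_n)$ exists, and each is regarded as a quandle representation of $\mathcal{R}_n$ via $x\mapsto$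 (action of $R_x$). *)

theory Defs
  imports
    "HOL-Analysis.Analysis"
    "HOL-Algebra.Bij"
    "HOL-Algebra.Generated_Groups"
    "HOL-Library.Function_Algebras"
begin

section \<open>Complex vector spaces\<close>

text \<open>
  The ambient space is a type, a vector space is a subspace of it. The type class only serves to
  supply the scalar multiplication; subspaces, spans, etc. are those of the library locale
  \<^locale>\<open>vector_space\<close>.
\<close>

class complex_vector = ab_group_add +
  fixes scaleC :: "complex \<Rightarrow> 'a \<Rightarrow> 'a"  (infixr "*\<^sub>C" 75)
  assumes scaleC_add_right: "a *\<^sub>C (x + y) = a *\<^sub>C x + a *\<^sub>C y"
    and scaleC_add_left: "(a + b) *\<^sub>C x = a *\<^sub>C x + b *\<^sub>C x"
    and scaleC_scaleC: "a *\<^sub>C (b *\<^sub>C x) = (a * b) *\<^sub>C x"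
    and scaleC_one: "1 *\<^sub>C x = x"

global_interpretation cvec: vector_space "scaleC :: complex \<Rightarrow> 'a \<Rightarrow> 'a::complex_vector"
  by unfold_locales (simp_all add: scaleC_add_right scaleC_add_left scaleC_scaleC scaleC_one)

instantiation complex :: complex_vector
begin
definition scaleC_complex_def: "a *\<^sub>C (z::complex) = a * z"
instance by standard (simp_all add: scaleC_complex_def algebra_simps)
end

instantiation prod :: (complex_vector, complex_vector) complex_vector
begin
definition scaleC_prod_def: "a *\<^sub>C p = (a *\<^sub>C fst p, a *\<^sub>C snd p)"
instance
  by standard
    (simp_all add: scaleC_prod_def scaleC_add_right scaleC_add_left scaleC_scaleC scaleC_one)
end

instantiation "fun" :: (type, complex_vector) complex_vector
begin
definition scaleC_fun_def: "a *\<^sub>C f = (\<lambda>x. a *\<^sub>C f x)"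
instance
  by standard
    (simp_all add: scaleC_fun_def plus_fun_def scaleC_add_right scaleC_add_left scaleC_scaleC scaleC_one)
end

instantiation vec :: (complex_vector, finite) complex_vector
begin
definition scaleC_vec_def: "a *\<^sub>C v = (\<chi> i. a *\<^sub>C v $ i)"
instance
  by standard
    (simp_all add: scaleC_vec_def vec_eq_iff scaleC_add_right scaleC_add_left scaleC_scaleC scaleC_one)
end

definition finite_dim_space :: "'v::complex_vector set \<Rightarrow> bool" where
  "finite_dim_space V \<longleftrightarrow> cvec.subspace V \<and> (\<exists>B. finite B \<and> cvec.span B = V)"

definition linear_on :: "'v::complex_vector set \<Rightarrow> ('v \<Rightarrow> 'w::complex_vector) \<Rightarrow> bool" where
  "linear_on V f \<longleftrightarrow>
     (\<forall>u\<in>V. \<forall>v\<in>V. f (u + v) = f u + f v) \<and> (\<forall>c. \<forall>v\<in>V. f (c *\<^sub>C v) = c *\<^sub>C f v)"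

text \<open>
  As in \<^const>\<open>BijGroup\<close>, the elements of \<open>GL V\<close> are extensional functions on \<open>V\<close>; this is why
  the actions below are written with a restriction to their space.
\<close>

definition GL :: "'v::complex_vector set \<Rightarrow> ('v \<Rightarrow> 'v) monoid" where
  "GL V = (BijGroup V)\<lparr>carrier := {g \<in> Bij V. linear_on V g}\<rparr>"


section \<open>Quandles\<close>

record 'a quandle = "'a partial_object" +
  qop :: "'a \<Rightarrow> 'a \<Rightarrow> 'a"  (infixl "\<triangleright>\<index>" 70)

locale rack =
  fixes X :: "('a, 'm) quandle_scheme" (structure)
  assumes closed: "x \<in> carrier X \<Longrightarrow> y \<in> carrier X \<Longrightarrow> x \<triangleright> y \<in> carrier X"
    and right_division: "x \<in> carrier X \<Longrightarrow> y \<in> carrier X \<Longrightarrow> \<exists>!z. z \<in> carrier X \<and> y = z \<triangleright> x"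
    and self_distrib: "x \<in> carrier X \<Longrightarrow> y \<in> carrier X \<Longrightarrow> z \<in> carrier X \<Longrightarrow>
      (x \<triangleright> y) \<triangleright> z = (x \<triangleright> z) \<triangleright> (y \<triangleright> z)"

locale quandle = rack +
  assumes idem: "x \<in> carrier X \<Longrightarrow> x \<triangleright> x = x"

definition quandle_hom :: "('a, 'm) quandle_scheme \<Rightarrow> ('b, 'k) quandle_scheme \<Rightarrow> ('a \<Rightarrow> 'b) set" where
  "quandle_hom X Y = {f \<in> carrier X \<rightarrow> carrier Y.
     \<forall>x\<in>carrier X. \<forall>y\<in>carrier X. f (x \<triangleright>\<^bsub>X\<^esub> y) = f x \<triangleright>\<^bsub>Y\<^esub> f y}"

definition Conj :: "('g, 'm) monoid_scheme \<Rightarrow> 'g quandle" where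
  "Conj G = \<lparr>carrier = carrier G, qop = (\<lambda>x y. y \<otimes>\<^bsub>G\<^esub> x \<otimes>\<^bsub>G\<^esub> inv\<^bsub>G\<^esub> y)\<rparr>"

definition right_mult :: "('a, 'm) quandle_scheme \<Rightarrow> 'a \<Rightarrow> 'a \<Rightarrow> 'a" where
  "right_mult X x = (\<lambda>y\<in>carrier X. y \<triangleright>\<^bsub>X\<^esub> x)"

definition Inn :: "('a, 'm) quandle_scheme \<Rightarrow> ('a \<Rightarrow> 'a) monoid" where
  "Inn X = (BijGroup (carrier X))\<lparr>carrier :=
     generate (BijGroup (carrier X)) (right_mult X ` carrier X)\<rparr>"


section \<open>Representations of groups and of quandles\<close>

text \<open>Raw data of a representation: a space together with an action of the elements of type \<open>'x\<close>.\<close>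

record ('x, 'v) rep =
  rspace :: "'v set"
  ract :: "'x \<Rightarrow> 'v \<Rightarrow> 'v"

definition group_rep :: "('g, 'm) monoid_scheme \<Rightarrow> ('g, 'v::complex_vector) rep \<Rightarrow> bool" where
  "group_rep G A \<longleftrightarrow> finite_dim_space (rspace A) \<and> ract A \<in> hom G (GL (rspace A))"

definition quandle_rep :: "('a, 'm) quandle_scheme \<Rightarrow> ('a, 'v::complex_vector) rep \<Rightarrow> bool" where
  "quandle_rep X A \<longleftrightarrow> quandle X \<and> finite (carrier X) \<and> finite_dim_space (rspace A) \<and>
     ract A \<in> quandle_hom X (Conj (GL (rspace A)))"

definition subrep :: "('a, 'm) quandle_scheme \<Rightarrow> 'v set \<Rightarrow> ('a, 'v::complex_vector) rep \<Rightarrow> bool" where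
  "subrep X U A \<longleftrightarrow> cvec.subspace U \<and> U \<subseteq> rspace A \<and>
     (\<forall>x\<in>carrier X. \<forall>u\<in>U. ract A x u \<in> U)"

definition irreducible_rep ::
  "('a, 'm) quandle_scheme \<Rightarrow> ('a, 'v::complex_vector) rep \<Rightarrow> bool" where
  "irreducible_rep X A \<longleftrightarrow> quandle_rep X A \<and> (\<forall>U. subrep X U A \<longrightarrow> U = {0} \<or> U = rspace A)"

definition isomorphic_rep :: "('a, 'm) quandle_scheme \<Rightarrow> ('a, 'v::complex_vector) rep \<Rightarrow>
    ('a, 'w::complex_vector) rep \<Rightarrow> bool" where
  "isomorphic_rep X A B \<longleftrightarrow> quandle_rep X A \<and> quandle_rep X B \<and>
     (\<exists>\<phi>. linear_on (rspace A) \<phi> \<and> bij_betw \<phi> (rspace A) (rspace B) \<and>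
       (\<forall>x\<in>carrier X. \<forall>v\<in>rspace A. \<phi> (ract A x v) = ract B x (\<phi> v)))"

definition rep_sum :: "('x, 'v::complex_vector) rep \<Rightarrow> ('x, 'w::complex_vector) rep \<Rightarrow>
    ('x, 'v \<times> 'w) rep"  (infixr "\<boxplus>" 65) where
  "A \<boxplus> B = \<lparr>rspace = rspace A \<times> rspace B,
     ract = (\<lambda>x. \<lambda>p \<in> rspace A \<times> rspace B. (ract A x (fst p), ract B x (snd p)))\<rparr>"

text \<open>
  External direct sum of a family over a finite index set \<open>S\<close>. Its vectors are the families
  \<open>(f s)\<close>, \<open>s \<in> S\<close>, extended by zero outside \<open>S\<close>, so that the sum over the empty set is zero.
\<close>

definition rep_Sum :: "'s set \<Rightarrow> ('s \<Rightarrow> ('x, 'v::complex_vector) rep) \<Rightarrow> ('x, 's \<Rightarrow> 'v) rep" where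
  "rep_Sum S A =
    (let V = {f. (\<forall>s\<in>S. f s \<in> rspace (A s)) \<and> (\<forall>s. s \<notin> S \<longrightarrow> f s = 0)}
     in \<lparr>rspace = V, ract = (\<lambda>x. \<lambda>f\<in>V. \<lambda>s. if s \<in> S then ract (A s) x (f s) else 0)\<rparr>)"

definition induced_rep ::
  "('a, 'm) quandle_scheme \<Rightarrow> ('a \<Rightarrow> 'a, 'v) rep \<Rightarrow> ('a, 'v) rep" where
  "induced_rep X A = \<lparr>rspace = rspace A, ract = (\<lambda>x. ract A (right_mult X x))\<rparr>"

text \<open>Functions on \<open>X\<close> are encoded as functions on the type that vanish outside \<open>carrier X\<close>.\<close>

definition regular_rep :: "('a, 'm) quandle_scheme \<Rightarrow> ('a, 'a \<Rightarrow> complex) rep" where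
  "regular_rep X =
    (let V = {f. \<forall>x. x \<notin> carrier X \<longrightarrow> f x = 0}
     in \<lparr>rspace = V, ract = (\<lambda>t. \<lambda>f\<in>V. \<lambda>x.
           if x \<in> carrier X then f (inv_into (carrier X) (right_mult X t) x) else 0)\<rparr>)"


section \<open>Dihedral quandles and their representations\<close>

text \<open>The representative in \<open>{1..n}\<close> of the residue class of \<open>k\<close> modulo \<open>n\<close>.\<close>

definition residue_rep :: "nat \<Rightarrow> int \<Rightarrow> int" where
  "residue_rep n k = (k - 1) mod int n + 1"

definition dihedral :: "nat \<Rightarrow> int quandle" where
  "dihedral n = \<lparr>carrier = {1..int n}, qop = (\<lambda>x y. residue_rep n (2 * y - x))\<rparr>"

text \<open>\<open>R\<^sub>k\<close> with the subscript read modulo \<open>n\<close>; in particular \<open>R\<^sub>2 = R\<^sub>1\<close> if \<open>n = 1\<close>.\<close>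

definition dihedral_R :: "nat \<Rightarrow> int \<Rightarrow> int \<Rightarrow> int" where
  "dihedral_R n k = right_mult (dihedral n) (residue_rep n k)"

definition is_char_rep :: "nat \<Rightarrow> complex \<Rightarrow> complex \<Rightarrow> (int \<Rightarrow> int, complex) rep \<Rightarrow> bool" where
  "is_char_rep n l \<mu> A \<longleftrightarrow> group_rep (Inn (dihedral n)) A \<and> rspace A = UNIV \<and>
     ract A (dihedral_R n 1) = (\<lambda>z. l * z) \<and>
     ract A (dihedral_R n 2) = (\<lambda>z. \<mu> * z)"

definition is_W_rep :: "nat \<Rightarrow> complex \<Rightarrow> (int \<Rightarrow> int, complex ^ 2) rep \<Rightarrow> bool" where
  "is_W_rep n l A \<longleftrightarrow> group_rep (Inn (dihedral n)) A \<and> rspace A = UNIV \<and>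
     ract A (dihedral_R n 1) =
       (\<lambda>v. (vector [vector [0, 1], vector [1, 0]] :: complex ^ 2 ^ 2) *v v) \<and>
     ract A (dihedral_R n 2) =
       (\<lambda>v. (vector [vector [0, l], vector [inverse l, 0]] :: complex ^ 2 ^ 2) *v v)"

text \<open>
  \<open>R\<^sub>1\<close> and \<open>R\<^sub>2\<close> generate the inner automorphism group, so a representation as described by
  \<^const>\<open>is_char_rep\<close> or \<^const>\<open>is_W_rep\<close> is unique on that group if it exists, and the choice below
  does not affect the induced action of the quandle. Where it does not exist, \<open>char_rep\<close> and
  \<open>W_rep\<close> are meaningless; use them together with existence.
\<close>

definition char_rep :: "nat \<Rightarrow> complex \<Rightarrow> complex \<Rightarrow> (int, complex) rep" where
  "char_rep n l \<mu> = induced_rep (dihedral n) (SOME A. is_char_rep n l \<mu> A)"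

definition W_rep :: "nat \<Rightarrow> complex \<Rightarrow> (int, complex ^ 2) rep" where
  "W_rep n l = induced_rep (dihedral n) (SOME A. is_W_rep n l A)"

definition root_unity :: "nat \<Rightarrow> complex" where
  "root_unity k = exp (2 * of_real pi * \<i> / of_nat k)"

end

(*
  Let E(j) = exp(2 pi i j / n). For every k the vectors (E(k(x-1)), E(-k(x-1))), x in R_n, are permuted
  by the reflections x |-> 2t - x in the way prescribed by W(E(2k)). A spanning family of vectors which
  is permuted like this determines a representation of Inn(R_n), which gives existence, and sending e_x
  to the x-th vector is an intertwiner from the regular representation. The sum of these intertwiners is
  the discrete Fourier transform with its frequencies grouped in pairs k, -k, hence bijective. For n = 2m
  the frequencies k and m + k give the same W; the self-paired frequencies 0 and m give trivial
  representations, and W(-1) (at k = n/4) splits into two characters.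
*)

theory Submission
  imports Defs
begin

section \<open>Linear maps and representations\<close>

text \<open>\<open>char_rep\<close> and \<open>W_rep\<close> are choices specified on R_1 and R_2
  alone, whereas \<open>isomorphic_rep\<close> speaks of every R_x. The gap is closed by the
  relation R_(2j-k) R_j = R_j R_k: it holds for the reflections and for the maps \<open>a k\<close>,
  so agreement at two consecutive indices propagates to all. In this form the argument covers small
  \<open>n\<close>, where R_1 and R_2 coincide, together with the general case.
  \<open>isomorphic_rep\<close> also requires its target to be a representation. For the nested
  direct sums this is transported from the regular representation along the intertwiner, whose
  bijectivity is settled frequency by frequency.\<close>

lemma linear_on_eqI:
  fixes f g :: "'v::complex_vector \<Rightarrow> 'w::complex_vector"
  assumes f: "linear_on UNIV f" and g: "linear_on UNIV g"
    and eq: "\<And>b. b \<in> B \<Longrightarrow> f b = g b" and B: "cvec.span B = UNIV"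
  shows "f = g"
proof
  fix v
  have "v \<in> cvec.span B" by (simp add: B)
  then show "f v = g v"
  proof (induction rule: cvec.span_induct_alt)
    case base
    \<comment> \<open>\<open>linear_on\<close> states additivity and homogeneity; scaling by 0 turns
      the latter into \<open>f 0 = 0\<close>.\<close>
    have "f (0 *\<^sub>C 0) = g (0 *\<^sub>C 0)"
      using f g unfolding linear_on_def by (metis UNIV_I cvec.scale_zero_left)
    then show ?case by simp
  next
    case (step c x y)
    then show ?case using f g eq unfolding linear_on_def by simp
  qed
qed

lemma linear_on_compose:
  "linear_on V g \<Longrightarrow> linear_on W f \<Longrightarrow> g \<in> V \<rightarrow> W \<Longrightarrow> linear_on V (\<lambda>v. f (g v))"
  unfolding linear_on_def by (simp add: Pi_iff)

lemma linear_on_sum: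
  assumes f: "linear_on V f" and V: "cvec.subspace V" and I: "finite I"
    and v: "\<And>i. i \<in> I \<Longrightarrow> v i \<in> V"
  shows "f (\<Sum>i\<in>I. c i *\<^sub>C v i) = (\<Sum>i\<in>I. c i *\<^sub>C f (v i))"
  using I v
proof (induction I rule: finite_induct)
  case empty
  have "f (0 *\<^sub>C 0) = 0 *\<^sub>C f 0"
    using f cvec.subspace_0[OF V] unfolding linear_on_def by blast
  then show ?case by simp
next
  case (insert i I)
  have "(\<Sum>i\<in>I. c i *\<^sub>C v i) \<in> V" "c i *\<^sub>C v i \<in> V"
    using insert.prems by (auto intro!: cvec.subspace_sum cvec.subspace_scale V)
  then show ?case
    using f insert unfolding linear_on_def by simp
qed

lemma subspace_linear_image:
  assumes f: "linear_on V f" and V: "cvec.subspace V"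
  shows "cvec.subspace (f ` V)"
proof (rule cvec.subspaceI)
  have "f (0 *\<^sub>C 0) = 0 *\<^sub>C f 0"
    using f cvec.subspace_0[OF V] unfolding linear_on_def by blast
  then have "f 0 = 0" by simp
  then show "0 \<in> f ` V" using cvec.subspace_0[OF V] by (metis imageI)
next
  fix x y assume "x \<in> f ` V" "y \<in> f ` V"
  then show "x + y \<in> f ` V"
    using f cvec.subspace_add[OF V] unfolding linear_on_def by (smt (verit) image_iff)
next
  fix c x assume "x \<in> f ` V"
  then show "c *\<^sub>C x \<in> f ` V"
    using f cvec.subspace_scale[OF V] unfolding linear_on_def by (smt (verit) image_iff)
qed

lemma finite_dim_space_linear_image:
  assumes f: "linear_on V f" and V: "finite_dim_space V"
  shows "finite_dim_space (f ` V)"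
proof -
  have sub: "cvec.subspace V" using V by (simp add: finite_dim_space_def)
  obtain B where B: "finite B" "cvec.span B = V" using V by (auto simp: finite_dim_space_def)
  have BV: "B \<subseteq> V" using B cvec.span_superset by blast
  have "f v \<in> cvec.span (f ` B)" if "v \<in> cvec.span B" for v
  proof -
    \<comment> \<open>\<open>f\<close> is linear only on \<open>V\<close>, so membership in
      \<open>V\<close> has to be carried through the induction.\<close>
    have "v \<in> V \<and> f v \<in> cvec.span (f ` B)"
      using that
    proof (induction rule: cvec.span_induct_alt)
      case base
      have "f (0 *\<^sub>C 0) = 0 *\<^sub>C f 0"
        using f cvec.subspace_0[OF sub] unfolding linear_on_def by blast
      then have "f 0 = 0" by simp
      then show ?case using cvec.subspace_0[OF sub] by (simp add: cvec.span_zero)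
    next
      case (step c x y)
      then have x: "x \<in> V" "c *\<^sub>C x \<in> V" using BV cvec.subspace_scale[OF sub] by auto
      then have "f (c *\<^sub>C x + y) = c *\<^sub>C f x + f y"
        using f step unfolding linear_on_def by metis
      moreover have "c *\<^sub>C f x + f y \<in> cvec.span (f ` B)"
        using step by (intro cvec.span_add cvec.span_scale) (auto intro: cvec.span_base)
      ultimately show ?case using step x by (simp add: cvec.subspace_add[OF sub])
    qed
    then show ?thesis by blast
  qed
  moreover have "cvec.subspace (f ` V)" by (rule subspace_linear_image[OF f sub])
  moreover from this have "cvec.span (f ` B) \<subseteq> f ` V"
    using BV by (intro cvec.span_minimal image_mono)
  ultimately have "cvec.span (f ` B) = f ` V" using B by blast
  then show ?thesis
    using B \<open>cvec.subspace (f ` V)\<close> unfolding finite_dim_space_def by blast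
qed

text \<open>Lets \<open>GL V\<close> inherit its group laws from \<open>BijGroup V\<close>. The
  point is the inverse, whose additivity and homogeneity are checked after applying the injective
  \<open>g\<close>.\<close>

lemma subgroup_GL:
  assumes V: "cvec.subspace V"
  shows "subgroup {g \<in> Bij V. linear_on V g} (BijGroup V)"
proof (rule group.subgroupI[OF group_BijGroup])
  show "{g \<in> Bij V. linear_on V g} \<subseteq> carrier (BijGroup V)" by (auto simp: BijGroup_def)
  have "(\<lambda>x\<in>V. x) \<in> {g \<in> Bij V. linear_on V g}"
    using V by (auto simp: id_Bij linear_on_def cvec.subspace_add cvec.subspace_scale)
  then show "{g \<in> Bij V. linear_on V g} \<noteq> {}" by blast
next
  fix g assume "g \<in> {g \<in> Bij V. linear_on V g}"
  then have g: "g \<in> Bij V" "linear_on V g" by auto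
  then have b: "bij_betw g V V" by (simp add: Bij_def)
  let ?h = "inv_into V g"
  have mem: "?h v \<in> V" "g (?h v) = v" if "v \<in> V" for v
    using that b by (auto simp: bij_betw_def inv_into_into f_inv_into_f)
  have eqI: "x = y" if "x \<in> V" "y \<in> V" "g x = g y" for x y
    using that b by (auto simp: bij_betw_def inj_on_def)
  have "?h (u + v) = ?h u + ?h v" if "u \<in> V" "v \<in> V" for u v
    using that mem g(2) V by - (rule eqI, auto simp: linear_on_def cvec.subspace_add)
  moreover have "?h (c *\<^sub>C v) = c *\<^sub>C ?h v" if "v \<in> V" for c v
    using that mem g(2) V by - (rule eqI, auto simp: linear_on_def cvec.subspace_scale)
  ultimately have "linear_on V (restrict ?h V)"
    using V by (simp add: linear_on_def cvec.subspace_add cvec.subspace_scale)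
  then show "inv\<^bsub>BijGroup V\<^esub> g \<in> {g \<in> Bij V. linear_on V g}"
    using g by (simp add: inv_BijGroup restrict_inv_into_Bij)
next
  fix g h assume "g \<in> {g \<in> Bij V. linear_on V g}" "h \<in> {g \<in> Bij V. linear_on V g}"
  then have g: "g \<in> Bij V" "linear_on V g" and h: "h \<in> Bij V" "linear_on V h" by auto
  have "linear_on V (compose V g h)"
    using g(2) h(2) Bij_imp_funcset[OF h(1)] V
    by (auto simp: linear_on_def compose_def cvec.subspace_add cvec.subspace_scale Pi_iff)
  then show "g \<otimes>\<^bsub>BijGroup V\<^esub> h \<in> {g \<in> Bij V. linear_on V g}"
    using g h by (simp add: BijGroup_def compose_Bij)
qed

lemma group_GL: "cvec.subspace V \<Longrightarrow> group (GL V)"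
  unfolding GL_def by (rule group.subgroup_imp_group[OF group_BijGroup subgroup_GL])

lemma GL_mult: "g \<in> Bij V \<Longrightarrow> h \<in> Bij V \<Longrightarrow> g \<otimes>\<^bsub>GL V\<^esub> h = compose V g h"
  by (simp add: GL_def BijGroup_def)

lemma carrier_GL: "carrier (GL V) = {g \<in> Bij V. linear_on V g}"
  by (simp add: GL_def)

text \<open>The conjugation relation is multiplied by \<open>ract A y\<close> on the right. This
  removes the inverse in \<open>GL\<close>, and the equation can be tested on vectors.\<close>

lemma quandle_rep_iff:
  "quandle_rep X A \<longleftrightarrow> quandle X \<and> finite (carrier X) \<and> finite_dim_space (rspace A) \<and>
     (\<forall>x\<in>carrier X. ract A x \<in> Bij (rspace A) \<and> linear_on (rspace A) (ract A x)) \<and>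
     (\<forall>x\<in>carrier X. \<forall>y\<in>carrier X. \<forall>v\<in>rspace A.
        ract A (x \<triangleright>\<^bsub>X\<^esub> y) (ract A y v) = ract A y (ract A x v))"
    (is "_ \<longleftrightarrow> ?q \<and> ?f \<and> ?d \<and> ?l \<and> ?c")
proof (cases "?q \<and> ?f \<and> ?d \<and> ?l")
  case True
  let ?V = "rspace A" and ?\<rho> = "ract A"
  interpret quandle X using True by blast
  have sub: "cvec.subspace ?V" using True by (simp add: finite_dim_space_def)
  interpret G: group "GL ?V" by (rule group_GL[OF sub])
  have mem: "?\<rho> x \<in> carrier (GL ?V)" if "x \<in> carrier X" for x
    using True that by (simp add: carrier_GL)
  have "?\<rho> (x \<triangleright>\<^bsub>X\<^esub> y) = ?\<rho> y \<otimes>\<^bsub>GL ?V\<^esub> ?\<rho> x \<otimes>\<^bsub>GL ?V\<^esub> inv\<^bsub>GL ?V\<^esub> ?\<rho> y \<longleftrightarrow>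
      (\<forall>v\<in>?V. ?\<rho> (x \<triangleright>\<^bsub>X\<^esub> y) (?\<rho> y v) = ?\<rho> y (?\<rho> x v))"
    if xy: "x \<in> carrier X" "y \<in> carrier X" for x y
  proof -
    note m = mem[OF xy(1)] mem[OF xy(2)] mem[OF closed[OF xy]]
    have "?\<rho> (x \<triangleright>\<^bsub>X\<^esub> y) = ?\<rho> y \<otimes>\<^bsub>GL ?V\<^esub> ?\<rho> x \<otimes>\<^bsub>GL ?V\<^esub> inv\<^bsub>GL ?V\<^esub> ?\<rho> y \<longleftrightarrow>
        ?\<rho> (x \<triangleright>\<^bsub>X\<^esub> y) \<otimes>\<^bsub>GL ?V\<^esub> ?\<rho> y = ?\<rho> y \<otimes>\<^bsub>GL ?V\<^esub> ?\<rho> x"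
      using m by (metis G.inv_solve_right G.m_closed)
    also have "\<dots> \<longleftrightarrow> compose ?V (?\<rho> (x \<triangleright>\<^bsub>X\<^esub> y)) (?\<rho> y) = compose ?V (?\<rho> y) (?\<rho> x)"
      using m by (simp add: GL_mult carrier_GL)
    also have "\<dots> \<longleftrightarrow> (\<forall>v\<in>?V. ?\<rho> (x \<triangleright>\<^bsub>X\<^esub> y) (?\<rho> y v) = ?\<rho> y (?\<rho> x v))"
      by (auto simp: compose_def fun_eq_iff restrict_def)
    finally show ?thesis .
  qed
  then show ?thesis
    using True mem unfolding quandle_rep_def quandle_hom_def Conj_def by auto
next
  \<comment> \<open>Both sides imply the four conditions, so both are false here.\<close>
  case False
  then show ?thesis
    unfolding quandle_rep_def quandle_hom_def Conj_def by (auto simp: carrier_GL)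
qed

section \<open>Linear actions, their direct sums and transport along intertwiners\<close>

text \<open>Collects the conditions that direct sums inherit componentwise. Extensionality is among
  them because \<open>Bij\<close> asks for it and an intertwiner says nothing about values outside
  the space; the rest of \<open>quandle_rep\<close> comes by transport.\<close>

definition linear_action :: "('a, 'm) quandle_scheme \<Rightarrow> ('a, 'v::complex_vector) rep \<Rightarrow> bool" where
  "linear_action X A \<longleftrightarrow> cvec.subspace (rspace A) \<and> (\<forall>x\<in>carrier X.
     ract A x \<in> extensional (rspace A) \<inter> (rspace A \<rightarrow> rspace A) \<and> linear_on (rspace A) (ract A x))"

lemma quandle_rep_imp_linear_action: "quandle_rep X A \<Longrightarrow> linear_action X A"
  unfolding quandle_rep_iff linear_action_def finite_dim_space_def
  by (auto simp: Bij_imp_extensional dest: Bij_imp_funcset)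

lemma rspace_rep_sum [simp]: "rspace (A \<boxplus> B) = rspace A \<times> rspace B"
  by (simp add: rep_sum_def)

lemma ract_rep_sum [simp]:
  "p \<in> rspace A \<times> rspace B \<Longrightarrow> ract (A \<boxplus> B) x p = (ract A x (fst p), ract B x (snd p))"
  by (simp add: rep_sum_def)

lemma rspace_rep_Sum:
  "rspace (rep_Sum S A) = {f. (\<forall>s\<in>S. f s \<in> rspace (A s)) \<and> (\<forall>s. s \<notin> S \<longrightarrow> f s = 0)}"
  by (simp add: rep_Sum_def Let_def)

lemma ract_rep_Sum:
  "f \<in> rspace (rep_Sum S A) \<Longrightarrow>
     ract (rep_Sum S A) x f = (\<lambda>s. if s \<in> S then ract (A s) x (f s) else 0)"
  by (simp add: rep_Sum_def Let_def)

lemma linear_action_rep_sum: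
  assumes A: "linear_action X A" and B: "linear_action X B"
  shows "linear_action X (A \<boxplus> B)"
  unfolding linear_action_def
proof (intro conjI ballI)
  have sub: "cvec.subspace (rspace A)" "cvec.subspace (rspace B)"
    using A B by (auto simp: linear_action_def)
  show "cvec.subspace (rspace (A \<boxplus> B))"
    using sub by (auto simp: cvec.subspace_def scaleC_prod_def zero_prod_def)
  fix x assume x: "x \<in> carrier X"
  then have "ract A x \<in> rspace A \<rightarrow> rspace A" "ract B x \<in> rspace B \<rightarrow> rspace B"
    using A B by (auto simp: linear_action_def)
  then show "ract (A \<boxplus> B) x \<in> extensional (rspace (A \<boxplus> B)) \<inter> (rspace (A \<boxplus> B) \<rightarrow> rspace (A \<boxplus> B))"
    by (auto simp: rep_sum_def)
  have "linear_on (rspace A) (ract A x)" "linear_on (rspace B) (ract B x)"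
    using A B x by (auto simp: linear_action_def)
  then show "linear_on (rspace (A \<boxplus> B)) (ract (A \<boxplus> B) x)"
    using sub by (auto simp: linear_on_def scaleC_prod_def cvec.subspace_add cvec.subspace_scale)
qed

lemma linear_action_rep_Sum:
  assumes A: "\<And>s. s \<in> S \<Longrightarrow> linear_action X (A s)"
  shows "linear_action X (rep_Sum S A)"
  unfolding linear_action_def
proof (intro conjI ballI)
  have sub: "cvec.subspace (rspace (A s))" if "s \<in> S" for s
    using A[OF that] by (simp add: linear_action_def)
  show S: "cvec.subspace (rspace (rep_Sum S A))"
    using sub by (auto simp: cvec.subspace_def rspace_rep_Sum scaleC_fun_def zero_fun_def)
  fix x assume x: "x \<in> carrier X"
  have "ract (A s) x \<in> rspace (A s) \<rightarrow> rspace (A s)" if "s \<in> S" for s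
    using A[OF that] x by (auto simp: linear_action_def)
  then show "ract (rep_Sum S A) x \<in> extensional (rspace (rep_Sum S A)) \<inter>
      (rspace (rep_Sum S A) \<rightarrow> rspace (rep_Sum S A))"
    unfolding rep_Sum_def Let_def by (auto simp: Pi_iff)
  have lin: "linear_on (rspace (A s)) (ract (A s) x)" if "s \<in> S" for s
    using A[OF that] x by (auto simp: linear_action_def)
  show "linear_on (rspace (rep_Sum S A)) (ract (rep_Sum S A) x)"
    unfolding linear_on_def
  proof (intro conjI ballI allI)
    fix u v assume uv: "u \<in> rspace (rep_Sum S A)" "v \<in> rspace (rep_Sum S A)"
    show "ract (rep_Sum S A) x (u + v) = ract (rep_Sum S A) x u + ract (rep_Sum S A) x v"
      using uv lin cvec.subspace_add[OF S uv]
      by (auto simp: ract_rep_Sum fun_eq_iff linear_on_def rspace_rep_Sum)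
  next
    fix c v assume v: "v \<in> rspace (rep_Sum S A)"
    show "ract (rep_Sum S A) x (c *\<^sub>C v) = c *\<^sub>C ract (rep_Sum S A) x v"
      using v lin cvec.subspace_scale[OF S v]
      by (auto simp: ract_rep_Sum fun_eq_iff linear_on_def rspace_rep_Sum scaleC_fun_def)
  qed
qed

text \<open>\<open>\<phi>\<close> conjugates each \<open>ract A x\<close> into
  \<open>ract B x\<close>, so bijectivity, finite dimension and the conjugation relation pass from
  \<open>A\<close> to \<open>B\<close>.\<close>

lemma isomorphic_rep_transport:
  assumes A: "quandle_rep X A" and B: "linear_action X B"
    and lin: "linear_on (rspace A) \<phi>" and bij: "bij_betw \<phi> (rspace A) (rspace B)"
    and eq: "\<And>x v. x \<in> carrier X \<Longrightarrow> v \<in> rspace A \<Longrightarrow> \<phi> (ract A x v) = ract B x (\<phi> v)"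
  shows "isomorphic_rep X A B"
proof -
  interpret quandle X using A by (simp add: quandle_rep_iff)
  have img: "rspace B = \<phi> ` rspace A" using bij by (simp add: bij_betw_def)
  have Abij: "bij_betw (ract A x) (rspace A) (rspace A)" if "x \<in> carrier X" for x
    using A that by (auto simp: quandle_rep_iff Bij_def)
  then have Amem: "ract A x v \<in> rspace A" if "x \<in> carrier X" "v \<in> rspace A" for x v
    using that by (auto simp: bij_betw_def)
  have "bij_betw (ract B x) (rspace B) (rspace B)" if x: "x \<in> carrier X" for x
  proof -
    let ?\<psi> = "inv_into (rspace A) \<phi>"
    have "bij_betw (\<phi> \<circ> (ract A x \<circ> ?\<psi>)) (rspace B) (rspace B)"
      by (rule bij_betw_trans[OF bij_betw_trans[OF bij_betw_inv_into[OF bij] Abij[OF x]] bij])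
    moreover have "(\<phi> \<circ> (ract A x \<circ> ?\<psi>)) v = ract B x v" if "v \<in> rspace B" for v
      using that img by (auto simp: eq x inv_into_into f_inv_into_f)
    ultimately show ?thesis by (subst (asm) bij_betw_cong) auto
  qed
  moreover have "finite_dim_space (rspace B)"
    unfolding img using A lin by (auto simp: quandle_rep_iff intro: finite_dim_space_linear_image)
  moreover have "ract B (x \<triangleright>\<^bsub>X\<^esub> y) (ract B y v) = ract B y (ract B x v)"
    if xy: "x \<in> carrier X" "y \<in> carrier X" and v: "v \<in> rspace B" for x y v
  proof -
    obtain u where u: "u \<in> rspace A" "v = \<phi> u" using v img by blast
    have "ract A (x \<triangleright>\<^bsub>X\<^esub> y) (ract A y u) = ract A y (ract A x u)"
      using A xy u by (simp add: quandle_rep_iff)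
    then show ?thesis
      using u xy by (simp add: eq[symmetric] Amem closed)
  qed
  ultimately have "quandle_rep X B"
    using A B by (auto simp: quandle_rep_iff linear_action_def Bij_def)
  then show ?thesis
    using A lin bij eq unfolding isomorphic_rep_def by blast
qed

section \<open>Dihedral quandles\<close>

lemma residue_rep_mod [simp]: "residue_rep n k mod int n = k mod int n"
  unfolding residue_rep_def by (metis diff_add_cancel mod_add_left_eq)

lemma residue_rep_cong: "j mod int n = k mod int n \<Longrightarrow> residue_rep n j = residue_rep n k"
  unfolding residue_rep_def by (metis mod_diff_left_eq)

lemma residue_rep_in: "n > 0 \<Longrightarrow> residue_rep n k \<in> {1..int n}"
  unfolding residue_rep_def by (simp add: add1_zle_eq)

lemma residue_rep_ident: "x \<in> {1..int n} \<Longrightarrow> residue_rep n x = x"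
  unfolding residue_rep_def by simp

text \<open>Together with its right-hand companion, this strips the inner residues from composed
  reflections, leaving an identity between integers.\<close>

lemma residue_rep_reflect_left:
  "residue_rep n (2 * residue_rep n j - k) = residue_rep n (2 * j - k)"
  by (rule residue_rep_cong) (metis residue_rep_mod mod_diff_eq mod_mult_right_eq)

lemma residue_rep_reflect_right:
  "residue_rep n (2 * j - residue_rep n k) = residue_rep n (2 * j - k)"
  by (rule residue_rep_cong) (metis residue_rep_mod mod_diff_eq)

lemma carrier_dihedral [simp]: "carrier (dihedral n) = {1..int n}"
  by (simp add: dihedral_def)

lemma qop_dihedral [simp]: "x \<triangleright>\<^bsub>dihedral n\<^esub> y = residue_rep n (2 * y - x)"
  by (simp add: dihedral_def)

lemma right_mult_dihedral:
  "right_mult (dihedral n) t = (\<lambda>x\<in>{1..int n}. residue_rep n (2 * t - x))"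
  by (simp add: right_mult_def)

lemma quandle_dihedral:
  assumes "n > 0"
  shows "quandle (dihedral n)"
proof
  fix x y assume x: "x \<in> carrier (dihedral n)" and y: "y \<in> carrier (dihedral n)"
  show "\<exists>!z. z \<in> carrier (dihedral n) \<and> y = z \<triangleright>\<^bsub>dihedral n\<^esub> x"
  \<comment> \<open>Reflection in \<open>x\<close> is an involution, so the solution is
    \<open>y \<triangleright> x\<close>.\<close>
  proof (rule ex1I[of _ "residue_rep n (2 * x - y)"])
    show "residue_rep n (2 * x - y) \<in> carrier (dihedral n) \<and>
        y = residue_rep n (2 * x - y) \<triangleright>\<^bsub>dihedral n\<^esub> x"
      using y assms residue_rep_in by (simp add: residue_rep_reflect_right residue_rep_ident)
  next
    fix z assume "z \<in> carrier (dihedral n) \<and> y = z \<triangleright>\<^bsub>dihedral n\<^esub> x"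
    then show "z = residue_rep n (2 * x - y)"
      by (simp add: residue_rep_reflect_right residue_rep_ident)
  qed
next
  fix x y z
  show "(x \<triangleright>\<^bsub>dihedral n\<^esub> y) \<triangleright>\<^bsub>dihedral n\<^esub> z =
      (x \<triangleright>\<^bsub>dihedral n\<^esub> z) \<triangleright>\<^bsub>dihedral n\<^esub> (y \<triangleright>\<^bsub>dihedral n\<^esub> z)"
    by (simp only: qop_dihedral residue_rep_reflect_right residue_rep_reflect_left)
      (simp add: algebra_simps)
qed (use assms residue_rep_in in \<open>simp_all add: residue_rep_ident\<close>)

text \<open>Reflections are involutions. The second claim makes inverses of generators into
  generators again and identifies the \<open>inv_into\<close> in the regular representation.\<close>

lemma right_mult_dihedral_Bij:
  assumes "n > 0"
  shows "right_mult (dihedral n) t \<in> Bij {1..int n}"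
    and "inv\<^bsub>BijGroup {1..int n}\<^esub> right_mult (dihedral n) t = right_mult (dihedral n) t"
proof -
  let ?R = "right_mult (dihedral n) t"
  have mem: "?R x \<in> {1..int n}" and inv: "?R (?R x) = x" if "x \<in> {1..int n}" for x
    using that assms residue_rep_in[OF assms]
    by (simp_all only: right_mult_dihedral restrict_apply if_True)
       (simp add: residue_rep_reflect_right residue_rep_ident)
  show Bij: "?R \<in> Bij {1..int n}"
    unfolding Bij_def
    by (intro IntI CollectI bij_betwI[where g = ?R]) (use mem inv in \<open>auto simp: right_mult_dihedral\<close>)
  interpret group "BijGroup {1..int n}" by (rule group_BijGroup)
  have "compose {1..int n} ?R ?R = (\<lambda>x\<in>{1..int n}. x)"
    using inv by (auto simp: compose_def fun_eq_iff)
  then show "inv\<^bsub>BijGroup {1..int n}\<^esub> ?R = ?R"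
    using Bij by (intro inv_equality) (simp_all add: BijGroup_def)
qed

section \<open>The inner automorphism group of the dihedral quandle\<close>

lemma carrier_Inn_dihedral:
  "carrier (Inn (dihedral n)) = generate (BijGroup {1..int n}) (right_mult (dihedral n) ` {1..int n})"
  by (simp add: Inn_def)

lemma Inn_dihedral_Bij:
  assumes "n > 0" "g \<in> carrier (Inn (dihedral n))"
  shows "g \<in> Bij {1..int n}"
proof -
  interpret group "BijGroup {1..int n}" by (rule group_BijGroup)
  have "right_mult (dihedral n) ` {1..int n} \<subseteq> carrier (BijGroup {1..int n})"
    using right_mult_dihedral_Bij[OF assms(1)] by (auto simp: BijGroup_def)
  from generate_in_carrier[OF this assms(2)[unfolded carrier_Inn_dihedral]] show ?thesis
    by (simp add: BijGroup_def)
qed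

lemma Inn_dihedral_mult:
  assumes "n > 0" "g \<in> carrier (Inn (dihedral n))" "h \<in> carrier (Inn (dihedral n))"
  shows "g \<otimes>\<^bsub>Inn (dihedral n)\<^esub> h = compose {1..int n} g h"
  using Inn_dihedral_Bij[OF assms(1,2)] Inn_dihedral_Bij[OF assms(1,3)]
  by (simp add: Inn_def BijGroup_def)

lemma dihedral_R_in_Inn:
  assumes "n > 0"
  shows "dihedral_R n k \<in> carrier (Inn (dihedral n))"
  unfolding carrier_Inn_dihedral dihedral_R_def
  using residue_rep_in[OF assms] by (blast intro: generate.incl)

lemma dihedral_R_apply:
  "x \<in> {1..int n} \<Longrightarrow> dihedral_R n k x = residue_rep n (2 * k - x)"
  by (simp add: dihedral_R_def right_mult_dihedral residue_rep_reflect_left)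

text \<open>Conjugating the reflection in \<open>k\<close> by that in \<open>j\<close> gives the
  reflection in the mirror image of \<open>k\<close>. For \<open>j = k + 1\<close> this expresses
  R_(k+2) through R_(k+1) and R_k.\<close>

lemma dihedral_R_conj:
  assumes "n > 0"
  shows "dihedral_R n (2 * j - k) \<otimes>\<^bsub>Inn (dihedral n)\<^esub> dihedral_R n j =
    dihedral_R n j \<otimes>\<^bsub>Inn (dihedral n)\<^esub> dihedral_R n k"
proof -
  have "dihedral_R n (2 * j - k) (dihedral_R n j x) = dihedral_R n j (dihedral_R n k x)"
    if "x \<in> {1..int n}" for x
    using that residue_rep_in[OF assms]
    by (simp only: dihedral_R_apply residue_rep_reflect_right) (simp add: algebra_simps)
  then have "compose {1..int n} (dihedral_R n (2 * j - k)) (dihedral_R n j) =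
      compose {1..int n} (dihedral_R n j) (dihedral_R n k)"
    by (auto simp: compose_def fun_eq_iff)
  then show ?thesis
    using assms dihedral_R_in_Inn by (simp add: Inn_dihedral_mult)
qed

text \<open>
  Equivariance of \<open>p\<close> and spanning determine how any element of the inner automorphism group has to
  act, so the formulas \<open>a k\<close> for the generators \<open>R\<^sub>k\<close> extend to a representation without checking
  relations between them. Indices are read modulo \<open>n\<close>.
\<close>

locale dihedral_action =
  fixes n :: nat and p :: "int \<Rightarrow> 'v::complex_vector" and a :: "int \<Rightarrow> 'v \<Rightarrow> 'v"
  assumes n_pos: "n > 0"
    and periodic: "x mod int n = y mod int n \<Longrightarrow> p x = p y"
    and linear: "linear_on UNIV (a k)"
    and equivariant: "a k (p x) = p (2 * k - x)"
    and spanning: "cvec.span (range p) = UNIV"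
begin

lemma p_residue_rep [simp]: "p (residue_rep n x) = p x"
  by (rule periodic) simp

lemma range_p: "range p = p ` {1..int n}"
  using residue_rep_in[OF n_pos] by (metis (no_types, lifting) image_subset_iff p_residue_rep rangeI
      subsetI subset_antisym UNIV_I imageE image_eqI)

lemma eqI:
  assumes "linear_on UNIV f" "linear_on UNIV g" "\<And>x. x \<in> {1..int n} \<Longrightarrow> f (p x) = g (p x)"
  shows "f = g"
  using assms spanning by (intro linear_on_eqI[of f g "range p"]) (auto simp: range_p)

lemma linear_comp:
  fixes f g :: "'v \<Rightarrow> 'v"
  shows "linear_on UNIV f \<Longrightarrow> linear_on UNIV g \<Longrightarrow> linear_on UNIV (\<lambda>v. f (g v))"
  by (rule linear_on_compose) auto

text \<open>Both sides send \<open>p x\<close> to \<open>p (2 * (j - k) + x)\<close>, and these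
  vectors span.\<close>

lemma a_conj: "a (2 * j - k) (a j v) = a j (a k v)"
proof -
  have "(\<lambda>v. a (2 * j - k) (a j v)) = (\<lambda>v. a j (a k v))"
    by (rule eqI) (simp_all add: linear linear_comp equivariant algebra_simps)
  then show ?thesis by meson
qed

lemma a_involution: "a k (a k v) = v"
proof -
  have "linear_on UNIV (\<lambda>v::'v. v)" by (simp add: linear_on_def)
  then have "(\<lambda>v. a k (a k v)) = (\<lambda>v. v)"
    by (intro eqI) (simp_all add: linear linear_comp equivariant)
  then show ?thesis by meson
qed

lemma bij_a: "bij (a k)"
  by (rule o_bij[of "a k"]) (auto simp: a_involution)

lemma finite_dim: "finite_dim_space (UNIV :: 'v set)"
  unfolding finite_dim_space_def
  by (metis cvec.subspace_UNIV finite_atLeastAtMost_int finite_imageI range_p spanning)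

lemma extends_to_Inn:
  assumes "g \<in> carrier (Inn (dihedral n))"
  shows "\<exists>T. linear_on UNIV T \<and> bij T \<and> (\<forall>x\<in>{1..int n}. T (p x) = p (g x))"
  using assms unfolding carrier_Inn_dihedral
proof (induction rule: generate.induct)
  case one
  show ?case by (rule exI[of _ "\<lambda>v. v"]) (simp add: linear_on_def BijGroup_def bij_id[unfolded id_def])
next
  case (incl h)
  then obtain t where "h = right_mult (dihedral n) t" by auto
  then show ?case
    by (intro exI[of _ "a t"]) (simp add: linear bij_a equivariant right_mult_dihedral)
next
  case (inv h)
  then obtain t where "h = right_mult (dihedral n) t" by auto
  then show ?case
    by (intro exI[of _ "a t"])
      (simp add: linear bij_a equivariant right_mult_dihedral_Bij[OF n_pos], simp add: right_mult_dihedral)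
next
  case (eng g h)
  then obtain S T where S: "linear_on UNIV S" "bij S" "\<forall>x\<in>{1..int n}. S (p x) = p (g x)"
    and T: "linear_on UNIV T" "bij T" "\<forall>x\<in>{1..int n}. T (p x) = p (h x)" by blast
  have gh: "g \<in> Bij {1..int n}" "h \<in> Bij {1..int n}"
    using eng.hyps n_pos by (auto intro: Inn_dihedral_Bij simp: carrier_Inn_dihedral)
  have "linear_on UNIV (\<lambda>v. S (T v))" "bij (\<lambda>v. S (T v))"
    using S T linear_comp bij_comp[of T S] by (auto simp: comp_def)
  moreover have "S (T (p x)) = p ((g \<otimes>\<^bsub>BijGroup {1..int n}\<^esub> h) x)" if "x \<in> {1..int n}" for x
    using S T that gh funcset_mem[OF Bij_imp_funcset[OF gh(2)] that]
    by (simp add: BijGroup_def compose_def)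
  ultimately show ?case by blast
qed

lemma group_rep_exists:
  "\<exists>A. group_rep (Inn (dihedral n)) A \<and> rspace A = UNIV \<and> (\<forall>k. ract A (dihedral_R n k) = a k)"
proof -
  let ?I = "carrier (Inn (dihedral n))"
  \<comment> \<open>The choice is harmless: by \<open>eqI\<close> the third property determines
    \<open>T g\<close>, and the same uniqueness makes \<open>T\<close> multiplicative.\<close>
  obtain T where T: "\<And>g. g \<in> ?I \<Longrightarrow> linear_on UNIV (T g)" "\<And>g. g \<in> ?I \<Longrightarrow> bij (T g)"
    "\<And>g x. g \<in> ?I \<Longrightarrow> x \<in> {1..int n} \<Longrightarrow> T g (p x) = p (g x)"
    using extends_to_Inn by metis
  have inG: "T g \<in> carrier (GL UNIV)" if "g \<in> ?I" for g
    using T that by (simp add: carrier_GL Bij_def)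
  have "T (g \<otimes>\<^bsub>Inn (dihedral n)\<^esub> h) = T g \<otimes>\<^bsub>GL UNIV\<^esub> T h" if gh: "g \<in> ?I" "h \<in> ?I" for g h
  proof -
    have gB: "g \<in> Bij {1..int n}" and hB: "h \<in> Bij {1..int n}"
      using gh Inn_dihedral_Bij n_pos by auto
    have "g \<otimes>\<^bsub>Inn (dihedral n)\<^esub> h \<in> ?I"
      using gh generate.eng[of g _ _ h] by (simp add: Inn_def)
    then have "T (compose {1..int n} g h) = (\<lambda>v. T g (T h v))"
      using gh T funcset_mem[OF Bij_imp_funcset[OF hB]]
      by (intro eqI) (simp_all add: linear_comp Inn_dihedral_mult n_pos compose_def)
    also have "\<dots> = compose UNIV (T g) (T h)"
      by (simp add: fun_eq_iff compose_def)
    finally show ?thesis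
      using gh inG by (simp add: GL_mult carrier_GL Inn_dihedral_mult n_pos)
  qed
  then have "T \<in> hom (Inn (dihedral n)) (GL UNIV)"
    using inG by (auto simp: hom_def)
  moreover have "T (dihedral_R n k) = a k" for k
    using T dihedral_R_in_Inn[OF n_pos]
    by (intro eqI)
      (simp_all add: linear equivariant dihedral_R_apply)
  ultimately show ?thesis
    using finite_dim by (intro exI[of _ "\<lparr>rspace = UNIV, ract = T\<rparr>"]) (simp add: group_rep_def)
qed

text \<open>Meant for an \<open>A\<close> picked by \<open>SOME\<close>, of which only the values at
  R_1 and R_2 are known. The relation \<open>dihedral_R_conj\<close> with \<open>j = k + 1\<close>
  turns them into a two-step recursion.\<close>

lemma group_rep_determined:
  assumes A: "group_rep (Inn (dihedral n)) A" and UNIV: "rspace A = UNIV"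
    and 1: "ract A (dihedral_R n 1) = a 1" and 2: "ract A (dihedral_R n 2) = a 2"
  shows "ract A (dihedral_R n (1 + int i)) = a (1 + int i)"
proof (induction i rule: nat_less_induct)
  case (1 i)
  consider "i = 0" | "i = 1" | j where "i = Suc (Suc j)" by (metis One_nat_def not0_implies_Suc)
  then show ?case
  proof cases
    case (3 j)
    let ?I = "Inn (dihedral n)" and ?R = "dihedral_R n"
    have hom: "ract A \<in> hom ?I (GL UNIV)" using A UNIV by (simp add: group_rep_def)
    have mult: "ract A (?R k \<otimes>\<^bsub>?I\<^esub> ?R l) v = ract A (?R k) (ract A (?R l) v)" for k l v
      using hom_mult[OF hom dihedral_R_in_Inn[OF n_pos, of k] dihedral_R_in_Inn[OF n_pos, of l]]
        hom_in_carrier[OF hom dihedral_R_in_Inn[OF n_pos]]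
      by (simp add: carrier_GL GL_mult compose_def)
    let ?k = "1 + int j" and ?l = "1 + int (Suc j)"
    have ih: "ract A (?R ?k) = a ?k" "ract A (?R ?l) = a ?l" using 1 3 by auto
    have "ract A (?R (2 * ?l - ?k)) (a ?l v) = a (2 * ?l - ?k) (a ?l v)" for v
      using dihedral_R_conj[OF n_pos, of ?l ?k] mult[of ?l ?k v] mult[of "2 * ?l - ?k" ?l v]
      by (simp only: ih a_conj)
    \<comment> \<open>Every vector has the form \<open>a ?l v\<close>, since \<open>a ?l\<close> is
      an involution.\<close>
    then have "ract A (?R (2 * ?l - ?k)) v = a (2 * ?l - ?k) v" for v
      by (metis a_involution)
    then have "ract A (?R (2 * ?l - ?k)) = a (2 * ?l - ?k)" by (rule ext)
    moreover have "2 * ?l - ?k = 1 + int i" using 3 by simp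
    ultimately show ?thesis by metis
  qed (use assms in simp_all)
qed

lemma induced_rep_determined:
  assumes "group_rep (Inn (dihedral n)) A" "rspace A = UNIV"
    and "ract A (dihedral_R n 1) = a 1" "ract A (dihedral_R n 2) = a 2" and x: "x \<in> {1..int n}"
  shows "ract (induced_rep (dihedral n) A) x = a x"
  using group_rep_determined[OF assms(1-4), of "nat (x - 1)"] x residue_rep_ident[OF x]
  by (simp add: induced_rep_def dihedral_R_def)

lemma quandle_rep_dihedral:
  assumes "rspace B = UNIV" "\<And>x. x \<in> {1..int n} \<Longrightarrow> ract B x = a x"
  shows "quandle_rep (dihedral n) B"
proof -
  \<comment> \<open>The quandle product is a residue, while \<open>a_conj\<close> has the integer
    index \<open>2 * j - k\<close>; the two give the same map.\<close>
  have "a (residue_rep n k) = a k" for k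
    by (rule eqI) (simp_all add: linear equivariant, metis p_residue_rep residue_rep_reflect_left)
  then show ?thesis
    using assms residue_rep_in[OF n_pos] finite_dim
    by (simp add: quandle_rep_iff quandle_dihedral n_pos Bij_def bij_a linear a_conj)
qed

end

section \<open>The discrete Fourier transform\<close>

definition zeta :: "nat \<Rightarrow> int \<Rightarrow> complex" where
  "zeta n j = cis (2 * pi * of_int j / of_nat n)"

lemma zeta_0 [simp]: "zeta n 0 = 1"
  by (simp add: zeta_def)

lemma zeta_add: "zeta n (j + k) = zeta n j * zeta n k"
  by (simp add: zeta_def cis_mult add_divide_distrib ring_distribs)

lemma zeta_minus: "zeta n (- j) = inverse (zeta n j)"
  by (simp add: zeta_def)

lemma zeta_nonzero [simp]: "zeta n j \<noteq> 0"
  by (simp add: zeta_def)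

lemma zeta_mult_nat: "zeta n (int i * j) = zeta n j ^ i"
  by (simp add: zeta_def Complex.DeMoivre algebra_simps)

lemma zeta_eq_1_iff:
  assumes "n > 0"
  shows "zeta n j = 1 \<longleftrightarrow> int n dvd j"
proof -
  have "zeta n j = 1 \<longleftrightarrow> cos (2 * pi * of_int j / of_nat n) = 1"
    by (auto simp: zeta_def complex_eq_iff cos_one_sin_zero)
  also have "\<dots> \<longleftrightarrow> (\<exists>k. 2 * pi * of_int j / of_nat n = of_int k * 2 * pi)"
    by (rule cos_one_2pi_int)
  also have "\<dots> \<longleftrightarrow> (\<exists>k. real_of_int j = real_of_int (k * int n))"
    using assms by (auto simp: field_simps)
  also have "\<dots> \<longleftrightarrow> int n dvd j"
    by (simp only: of_int_eq_iff) (auto simp: dvd_def mult.commute)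
  finally show ?thesis .
qed

lemma zeta_cong:
  assumes "j mod int n = k mod int n"
  shows "zeta n j = zeta n k"
\<comment> \<open>For \<open>n = 0\<close>, division by zero makes every value
  \<open>cis 0 = 1\<close>.\<close>
proof (cases "n = 0")
  case False
  have "zeta n (j - k) = 1"
    using assms False by (simp add: zeta_eq_1_iff mod_eq_dvd_iff)
  then show ?thesis using zeta_add[of n "j - k" k] by simp
qed (simp add: zeta_def)

text \<open>Rewrites powers of the root of unity of order n/2 as even frequencies of order n, so
  that all three cases use \<open>zeta n\<close>.\<close>

lemma zeta_double: "zeta (2 * m) (2 * j) = zeta m j"
  by (simp add: zeta_def mult.assoc)

lemma root_unity_power: "root_unity n ^ s = zeta n (int s)"
proof -
  have "root_unity n = zeta n 1"
    by (simp add: root_unity_def zeta_def cis_conv_exp algebra_simps)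
  then show ?thesis using zeta_mult_nat[of n s 1] by simp
qed

text \<open>Orthogonality of characters: a geometric sum whose ratio is an n-th root of
  unity.\<close>

lemma sum_zeta:
  assumes "n > 0"
  shows "(\<Sum>k\<in>{0..<int n}. zeta n (k * j)) = (if int n dvd j then of_nat n else 0)"
proof -
  have "(\<Sum>k\<in>{0..<int n}. zeta n (k * j)) = (\<Sum>i<n. zeta n j ^ i)"
    by (rule sum.reindex_bij_witness[of _ int nat]) (auto simp: zeta_mult_nat[symmetric])
  moreover have "zeta n j ^ n = 1"
    using assms zeta_mult_nat[of n n j] by (simp add: zeta_eq_1_iff flip: zeta_mult_nat)
  ultimately show ?thesis
    using assms by (auto simp: zeta_eq_1_iff[symmetric] sum_gp_strict)
qed

text \<open>Sign and origin are adapted to \<open>W_map\<close>: the coordinates of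
  \<open>\<Sum>x. f x *\<^sub>C W_map n j x\<close> are the values at \<open>j\<close> and
  \<open>- j\<close>.\<close>

definition dft :: "nat \<Rightarrow> (int \<Rightarrow> complex) \<Rightarrow> int \<Rightarrow> complex" where
  "dft n f k = (\<Sum>x\<in>{1..int n}. f x * zeta n (k * (x - 1)))"

lemma dft_cong: "j mod int n = k mod int n \<Longrightarrow> dft n f j = dft n f k"
  unfolding dft_def by (intro sum.cong refl arg_cong2[where f = "(*)"] zeta_cong) (metis mod_mult_left_eq)

lemma dft_inversion:
  assumes "n > 0" "x \<in> {1..int n}"
  shows "(\<Sum>k\<in>{0..<int n}. dft n f k * zeta n (- (k * (x - 1)))) = of_nat n * f x"
proof -
  have e: "zeta n (k * (y - 1)) * zeta n (- (k * (x - 1))) = zeta n (k * (y - x))" for k y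
    by (simp add: algebra_simps flip: zeta_add)
  have "(\<Sum>k\<in>{0..<int n}. dft n f k * zeta n (- (k * (x - 1)))) =
      (\<Sum>k\<in>{0..<int n}. \<Sum>y\<in>{1..int n}. f y * zeta n (k * (y - x)))"
    by (simp add: dft_def sum_distrib_right mult.assoc e)
  also have "\<dots> = (\<Sum>y\<in>{1..int n}. f y * (\<Sum>k\<in>{0..<int n}. zeta n (k * (y - x))))"
    by (subst sum.swap) (simp add: sum_distrib_left)
  also have "\<dots> = (\<Sum>y\<in>{1..int n}. if y = x then of_nat n * f x else 0)"
  proof (intro sum.cong refl)
    fix y assume "y \<in> {1..int n}"
    then have "int n dvd y - x \<longleftrightarrow> y = x"
      using assms(2) by (metis mod_eq_dvd_iff residue_rep_cong residue_rep_ident)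
    then show "f y * (\<Sum>k\<in>{0..<int n}. zeta n (k * (y - x))) =
        (if y = x then of_nat n * f x else 0)"
      using assms by (simp add: sum_zeta)
  qed
  also have "\<dots> = of_nat n * f x" using assms by simp
  finally show ?thesis .
qed

lemma dft_inject:
  assumes "n > 0" "\<And>k. k \<in> {0..<int n} \<Longrightarrow> dft n f k = 0" "x \<in> {1..int n}"
  shows "f x = 0"
  using dft_inversion[OF assms(1,3), of f] assms(1,2) by simp

text \<open>The preimage is the inverse transform of \<open>c\<close>, cut off outside
  \<open>{1..int n}\<close> because vectors of the regular representation are encoded that
  way.\<close>

lemma dft_surject:
  assumes "n > 0"
  obtains f where "\<And>x. x \<notin> {1..int n} \<Longrightarrow> f x = 0" "\<And>k. k \<in> {0..<int n} \<Longrightarrow> dft n f k = c k"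
proof
  define g where "g x = (if x \<in> {1..int n} then
    (\<Sum>k\<in>{0..<int n}. c k * zeta n (- (k * (x - 1)))) / of_nat n else 0)" for x
  show "g x = 0" if "x \<notin> {1..int n}" for x using that by (simp only: g_def if_False)
  fix j assume j: "j \<in> {0..<int n}"
  have e: "zeta n (- (k * (x - 1))) * zeta n (j * (x - 1)) = zeta n ((x - 1) * (j - k))" for k x
    by (simp add: algebra_simps flip: zeta_add)
  have "of_nat n * dft n g j =
      (\<Sum>x\<in>{1..int n}. \<Sum>k\<in>{0..<int n}. c k * zeta n ((x - 1) * (j - k)))"
    unfolding dft_def sum_distrib_left using assms
    by (intro sum.cong refl) (simp add: g_def sum_distrib_right mult.assoc e)
  also have "\<dots> = (\<Sum>k\<in>{0..<int n}. c k * (\<Sum>x\<in>{1..int n}. zeta n ((x - 1) * (j - k))))"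
    by (subst sum.swap) (simp add: sum_distrib_left)
  also have "\<dots> = (\<Sum>k\<in>{0..<int n}. c k * (\<Sum>x\<in>{0..<int n}. zeta n (x * (j - k))))"
    by (intro sum.cong refl arg_cong2[where f = "(*)"]
        sum.reindex_bij_witness[of _ "\<lambda>x. x + 1" "\<lambda>x. x - 1"]) auto
  also have "\<dots> = (\<Sum>k\<in>{0..<int n}. if k = j then of_nat n * c j else 0)"
  proof (intro sum.cong refl)
    fix k assume k: "k \<in> {0..<int n}"
    then have "int n dvd j - k \<longleftrightarrow> k = j"
      using j by (auto simp flip: mod_eq_dvd_iff)
    then show "c k * (\<Sum>x\<in>{0..<int n}. zeta n (x * (j - k))) =
        (if k = j then of_nat n * c j else 0)"
      using assms by (simp add: sum_zeta)
  qed
  also have "\<dots> = of_nat n * c j" using j by simp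
  finally show "dft n g j = c j" using assms by simp
qed

section \<open>Intertwiners from the regular representation\<close>

lemma rspace_regular_dihedral:
  "rspace (regular_rep (dihedral n)) = {f. \<forall>x. x \<notin> {1..int n} \<longrightarrow> f x = 0}"
  by (simp add: regular_rep_def Let_def)

lemma ract_regular_dihedral:
  assumes "n > 0" "f \<in> rspace (regular_rep (dihedral n))"
  shows "ract (regular_rep (dihedral n)) t f =
    (\<lambda>x. if x \<in> {1..int n} then f (residue_rep n (2 * t - x)) else 0)"
proof -
  have "inv_into {1..int n} (right_mult (dihedral n) t) x = residue_rep n (2 * t - x)"
    if x: "x \<in> {1..int n}" for x
  proof -
    \<comment> \<open>The inverse in \<open>BijGroup\<close> is the restricted
      \<open>inv_into\<close>, and a reflection is its own inverse.\<close>
    have "inv_into {1..int n} (right_mult (dihedral n) t) x = right_mult (dihedral n) t x"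
      using right_mult_dihedral_Bij[OF assms(1), of t] inv_BijGroup x by (metis restrict_apply')
    then show ?thesis using x by (simp add: right_mult_dihedral)
  qed
  then show ?thesis
    using assms(2) by (auto simp: regular_rep_def Let_def)
qed

lemma quandle_rep_regular_dihedral:
  assumes n: "n > 0"
  shows "quandle_rep (dihedral n) (regular_rep (dihedral n))"
  unfolding quandle_rep_iff
proof (intro conjI ballI)
  let ?A = "regular_rep (dihedral n)"
  let ?V = "rspace ?A"
  note act = ract_regular_dihedral[OF n]
  note res = residue_rep_in[OF n]
  have sub: "cvec.subspace ?V"
    by (auto simp: cvec.subspace_def rspace_regular_dihedral scaleC_fun_def scaleC_complex_def)
  define e :: "int \<Rightarrow> int \<Rightarrow> complex" where "e y = (\<lambda>x. if x = y then 1 else 0)" for y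
  have "cvec.span (e ` {1..int n}) = ?V"
  proof
    show "cvec.span (e ` {1..int n}) \<subseteq> ?V"
      by (intro cvec.span_minimal sub) (auto simp: e_def mult_delta_right rspace_regular_dihedral)
    show "?V \<subseteq> cvec.span (e ` {1..int n})"
    proof
      fix f assume f: "f \<in> ?V"
      have ev: "(\<Sum>y\<in>I. f y *\<^sub>C e y) x = (\<Sum>y\<in>I. f y * e y x)" if "finite I" for I x
        using that by (induction I) (simp_all add: scaleC_fun_def scaleC_complex_def)
      have "f = (\<Sum>y\<in>{1..int n}. f y *\<^sub>C e y)"
        using f by (intro ext) (simp only: ev[OF finite_atLeastAtMost_int],
            auto simp: e_def mult_delta_right rspace_regular_dihedral)
      also have "\<dots> \<in> cvec.span (e ` {1..int n})"
        by (intro cvec.span_sum cvec.span_scale cvec.span_base) auto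
      finally show "f \<in> cvec.span (e ` {1..int n})" .
    qed
  qed
  then show "finite_dim_space ?V"
    unfolding finite_dim_space_def using sub by blast
  have mem: "ract ?A t f \<in> ?V" if "f \<in> ?V" for t f
    unfolding act[OF that] by (simp add: rspace_regular_dihedral)
  have inv: "ract ?A t (ract ?A t f) = f" if f: "f \<in> ?V" for t f
    using f res by (auto simp: act mem[OF f] residue_rep_reflect_right residue_rep_ident fun_eq_iff
        rspace_regular_dihedral simp del: atLeastAtMost_iff)
  show "ract ?A t \<in> Bij ?V" for t
    unfolding Bij_def
    by (intro IntI CollectI bij_betwI[where g = "ract ?A t"])
      (use mem inv in \<open>auto simp: regular_rep_def Let_def\<close>)
  show "linear_on ?V (ract ?A t)" for t
    using cvec.subspace_add[OF sub] cvec.subspace_scale[OF sub]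
    by (auto simp: linear_on_def act fun_eq_iff scaleC_fun_def scaleC_complex_def)
  show "ract ?A (x \<triangleright>\<^bsub>dihedral n\<^esub> y) (ract ?A y f) = ract ?A y (ract ?A x f)" if f: "f \<in> ?V" for x y f
  proof
    fix z
    \<comment> \<open>The action pulls functions back, so reflections compose in reverse order; up
      to residues both arguments are \<open>2 * x - 2 * y + z\<close>.\<close>
    have "residue_rep n (2 * y - residue_rep n (2 * residue_rep n (2 * y - x) - z)) =
        residue_rep n (2 * x - residue_rep n (2 * y - z))"
      by (simp only: residue_rep_reflect_right residue_rep_reflect_left) (simp add: algebra_simps)
    then show "ract ?A (x \<triangleright>\<^bsub>dihedral n\<^esub> y) (ract ?A y f) z = ract ?A y (ract ?A x f) z"
      using res by (simp add: act[OF f] act[OF mem[OF f], unfolded act[OF f]] del: atLeastAtMost_iff)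
  qed
qed (use n in \<open>simp_all add: quandle_dihedral\<close>)

text \<open>Maps \<open>p\<close> that extend linearly to an intertwiner \<open>e\<^sub>x \<mapsto> p x\<close> from the regular representation.\<close>

definition equivariant_map ::
  "nat \<Rightarrow> (int, 'v::complex_vector) rep \<Rightarrow> (int \<Rightarrow> 'v) \<Rightarrow> bool" where
  "equivariant_map n B p \<longleftrightarrow> linear_action (dihedral n) B \<and> range p \<subseteq> rspace B \<and>
     (\<forall>x y. x mod int n = y mod int n \<longrightarrow> p x = p y) \<and>
     (\<forall>t\<in>{1..int n}. \<forall>x. ract B t (p x) = p (2 * t - x))"

lemma equivariant_mapI:
  assumes "linear_action (dihedral n) B" "\<And>x. p x \<in> rspace B"
    and "\<And>x y. x mod int n = y mod int n \<Longrightarrow> p x = p y"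
    and "\<And>t x. t \<in> {1..int n} \<Longrightarrow> ract B t (p x) = p (2 * t - x)"
  shows "equivariant_map n B p"
  using assms unfolding equivariant_map_def by blast

lemma equivariant_mapD:
  assumes "equivariant_map n B p"
  shows "linear_action (dihedral n) B" "p x \<in> rspace B"
    and "x mod int n = y mod int n \<Longrightarrow> p x = p y"
    and "t \<in> {1..int n} \<Longrightarrow> ract B t (p x) = p (2 * t - x)"
  using assms unfolding equivariant_map_def by blast+

lemma equivariant_map_rep_sum:
  assumes p: "equivariant_map n A p" and q: "equivariant_map n B q"
  shows "equivariant_map n (A \<boxplus> B) (\<lambda>x. (p x, q x))"
proof (rule equivariant_mapI)
  show "(p x, q x) = (p y, q y)" if "x mod int n = y mod int n" for x y
    using equivariant_mapD(3)[OF p that] equivariant_mapD(3)[OF q that] by simp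
qed (use equivariant_mapD(1,2,4)[OF p] equivariant_mapD(1,2,4)[OF q]
  in \<open>auto intro: linear_action_rep_sum\<close>)

lemma equivariant_map_rep_Sum:
  assumes p: "\<And>s. s \<in> S \<Longrightarrow> equivariant_map n (A s) (p s)"
  shows "equivariant_map n (rep_Sum S A) (\<lambda>x s. if s \<in> S then p s x else 0)"
proof (rule equivariant_mapI)
  show "linear_action (dihedral n) (rep_Sum S A)"
    by (intro linear_action_rep_Sum equivariant_mapD(1)[OF p])
  show mem: "(\<lambda>s. if s \<in> S then p s x else 0) \<in> rspace (rep_Sum S A)" for x
    using equivariant_mapD(2)[OF p] by (simp add: rspace_rep_Sum)
  show "(\<lambda>s. if s \<in> S then p s x else 0) = (\<lambda>s. if s \<in> S then p s y else 0)"
    if "x mod int n = y mod int n" for x y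
    using equivariant_mapD(3)[OF p that] by auto
  show "ract (rep_Sum S A) t (\<lambda>s. if s \<in> S then p s x else 0) =
      (\<lambda>s. if s \<in> S then p s (2 * t - x) else 0)" if "t \<in> {1..int n}" for t x
    using equivariant_mapD(4)[OF p that] by (auto simp: ract_rep_Sum[OF mem])
qed

text \<open>By Fourier inversion a function on the quandle amounts to a free choice of coefficients
  at the frequencies \<open>{0..<int n}\<close>. Hence \<open>inj\<close> need only recover each
  coefficient from the image, and \<open>surj\<close> need only name coefficients that produce
  \<open>w\<close>.\<close>

lemma regular_dihedral_isomorphic:
  fixes p :: "int \<Rightarrow> 'v::complex_vector"
  assumes n: "n > 0" and p: "equivariant_map n B p"
    and inj: "\<And>f k. (\<Sum>x\<in>{1..int n}. f x *\<^sub>C p x) = 0 \<Longrightarrow> k \<in> {0..<int n} \<Longrightarrow> dft n f k = 0"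
    and surj: "\<And>w. w \<in> rspace B \<Longrightarrow>
      \<exists>c. \<forall>f. (\<forall>k\<in>{0..<int n}. dft n f k = c k) \<longrightarrow> (\<Sum>x\<in>{1..int n}. f x *\<^sub>C p x) = w"
  shows "isomorphic_rep (dihedral n) (regular_rep (dihedral n)) B"
proof (rule isomorphic_rep_transport[OF quandle_rep_regular_dihedral[OF n]])
  let ?A = "regular_rep (dihedral n)"
  define \<phi> where "\<phi> f = (\<Sum>x\<in>{1..int n}. f x *\<^sub>C p x)" for f
  show B: "linear_action (dihedral n) B" by (rule equivariant_mapD(1)[OF p])
  then have sub: "cvec.subspace (rspace B)" by (simp add: linear_action_def)
  have pB: "p x \<in> rspace B" for x by (rule equivariant_mapD(2)[OF p])
  have p_res: "p (residue_rep n x) = p x" for x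
    by (rule equivariant_mapD(3)[OF p]) simp
  have \<phi>_diff: "\<phi> (f - g) = \<phi> f - \<phi> g" for f g
    by (simp add: \<phi>_def cvec.scale_left_diff_distrib sum_subtractf)
  show "linear_on (rspace ?A) \<phi>"
    by (auto simp: linear_on_def \<phi>_def scaleC_add_left sum.distrib scaleC_fun_def scaleC_complex_def
        cvec.scale_sum_right)
  show "bij_betw \<phi> (rspace ?A) (rspace B)"
  proof (rule bij_betw_imageI)
    show "inj_on \<phi> (rspace ?A)"
    proof (rule inj_onI)
      fix f g assume fg: "f \<in> rspace ?A" "g \<in> rspace ?A" "\<phi> f = \<phi> g"
      then have "\<phi> (f - g) = 0" by (simp add: \<phi>_diff)
      then have "dft n (f - g) k = 0" if "k \<in> {0..<int n}" for k
        using inj that unfolding \<phi>_def by blast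
      then have "(f - g) x = 0" if "x \<in> {1..int n}" for x
        using dft_inject[OF n] that by blast
      then show "f = g" using fg by (auto simp: rspace_regular_dihedral fun_eq_iff) (metis eq_iff_diff_eq_0)
    qed
    show "\<phi> ` rspace ?A = rspace B"
    proof
      show "\<phi> ` rspace ?A \<subseteq> rspace B"
        by (auto simp: \<phi>_def intro!: cvec.subspace_sum cvec.subspace_scale sub pB)
      show "rspace B \<subseteq> \<phi> ` rspace ?A"
      proof
        fix w assume "w \<in> rspace B"
        then obtain c where c: "\<And>f. (\<forall>k\<in>{0..<int n}. dft n f k = c k) \<Longrightarrow> \<phi> f = w"
          using surj unfolding \<phi>_def by blast
        obtain f where "\<And>x. x \<notin> {1..int n} \<Longrightarrow> f x = 0" "\<And>k. k \<in> {0..<int n} \<Longrightarrow> dft n f k = c k"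
          using dft_surject[OF n] by metis
        then show "w \<in> \<phi> ` rspace ?A"
          using c unfolding rspace_regular_dihedral by blast
      qed
    qed
  qed
  fix t f assume t: "t \<in> carrier (dihedral n)" and f: "f \<in> rspace ?A"
  let ?r = "\<lambda>x. residue_rep n (2 * t - x)"
  have "\<phi> (ract ?A t f) = (\<Sum>x\<in>{1..int n}. f (?r x) *\<^sub>C p x)"
    by (simp add: \<phi>_def ract_regular_dihedral[OF n f])
  \<comment> \<open>Substituting along the reflection moves it from \<open>f\<close> to
    \<open>p\<close>.\<close>
  also have "\<dots> = (\<Sum>x\<in>{1..int n}. f x *\<^sub>C p (?r x))"
    by (rule sum.reindex_bij_witness[of _ ?r ?r])
      (use residue_rep_in[OF n] in \<open>simp_all add: residue_rep_reflect_right residue_rep_ident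
        del: atLeastAtMost_iff\<close>)
  also have "\<dots> = (\<Sum>x\<in>{1..int n}. f x *\<^sub>C ract B t (p x))"
  proof (intro sum.cong refl)
    fix x
    have "ract B t (p x) = p (2 * t - x)"
      using equivariant_mapD(4)[OF p] t by simp
    then show "f x *\<^sub>C p (?r x) = f x *\<^sub>C ract B t (p x)" by (simp add: p_res)
  qed
  also have "\<dots> = ract B t (\<phi> f)"
    unfolding \<phi>_def using B t
    by (intro linear_on_sum[symmetric, where V = "rspace B"]) (auto simp: linear_action_def pB)
  finally show "\<phi> (ract ?A t f) = ract B t (\<phi> f)" .
qed

section \<open>The representations \<open>\<complex>(\<lambda>,\<mu>)\<close> and \<open>W(\<lambda>)\<close>\<close>

text \<open>\<open>\<kappa> k\<close> is the scalar of R_k, hence the parameters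
  \<open>\<kappa> 1\<close> and \<open>\<kappa> 2\<close>. The same \<open>p\<close> yields
  existence of the representation and the intertwiner into it; a line has only trivial
  subspaces.\<close>

lemma char_rep_properties:
  fixes p \<kappa> :: "int \<Rightarrow> complex"
  assumes "dihedral_action n p (\<lambda>k z. \<kappa> k * z)"
  shows char_rep_exists: "\<exists>A. is_char_rep n (\<kappa> 1) (\<kappa> 2) A"
    and irreducible_char_rep: "irreducible_rep (dihedral n) (char_rep n (\<kappa> 1) (\<kappa> 2))"
    and equivariant_map_char_rep: "equivariant_map n (char_rep n (\<kappa> 1) (\<kappa> 2)) p"
proof -
  interpret dihedral_action n p "\<lambda>k z. \<kappa> k * z" by fact
  let ?B = "char_rep n (\<kappa> 1) (\<kappa> 2)"
  show ex: "\<exists>A. is_char_rep n (\<kappa> 1) (\<kappa> 2) A"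
    using group_rep_exists unfolding is_char_rep_def by metis
  define A where "A = (SOME A. is_char_rep n (\<kappa> 1) (\<kappa> 2) A)"
  have A: "is_char_rep n (\<kappa> 1) (\<kappa> 2) A"
    unfolding A_def by (rule someI_ex[OF ex])
  have B: "?B = induced_rep (dihedral n) A" by (simp add: char_rep_def A_def)
  have sp: "rspace ?B = UNIV" using A by (simp add: B induced_rep_def is_char_rep_def)
  have act: "ract ?B x = (\<lambda>z. \<kappa> x * z)" if "x \<in> {1..int n}" for x
    unfolding B by (rule induced_rep_determined) (use A that in \<open>auto simp: is_char_rep_def\<close>)
  have rep: "quandle_rep (dihedral n) ?B"
    by (rule quandle_rep_dihedral[OF sp act])
  show "irreducible_rep (dihedral n) ?B"
    unfolding irreducible_rep_def
  proof (intro conjI allI impI rep)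
    fix U assume "subrep (dihedral n) U ?B"
    then have U: "cvec.subspace U" by (simp add: subrep_def)
    show "U = {0} \<or> U = rspace ?B"
    proof (cases "U = {0}")
      case False
      then obtain u where u: "u \<in> U" "u \<noteq> 0" using cvec.subspace_0[OF U] by blast
      have "z \<in> U" for z
        using cvec.subspace_scale[OF U u(1), of "z / u"] u(2) by (simp add: scaleC_complex_def)
      then show ?thesis using sp by auto
    qed simp
  qed
  show "equivariant_map n ?B p"
    by (rule equivariant_mapI[OF quandle_rep_imp_linear_action[OF rep] _ periodic])
      (simp_all add: sp act equivariant)
qed

section \<open>Two-dimensional representations\<close>

text \<open>The action of R_k on W(\<lambda>) for \<lambda> = \<open>zeta n (2 * j)\<close>: the
  antidiagonal matrix with upper entry \<lambda>^(k-1) and lower entry its inverse.\<close>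

definition W_act :: "nat \<Rightarrow> int \<Rightarrow> int \<Rightarrow> complex ^ 2 \<Rightarrow> complex ^ 2" where
  "W_act n j k v = vector [zeta n (2 * j * (k - 1)) * v $ 2, zeta n (- (2 * j * (k - 1))) * v $ 1]"

text \<open>Positions are counted from 1 because R_1 reflects about 1 and has to act as the plain
  swap.\<close>

definition W_map :: "nat \<Rightarrow> int \<Rightarrow> int \<Rightarrow> complex ^ 2" where
  "W_map n j x = vector [zeta n (j * (x - 1)), zeta n (- (j * (x - 1)))]"

lemma W_map_cong:
  assumes "x mod int n = y mod int n"
  shows "W_map n j x = W_map n j y"
proof -
  have "(j * (x - 1)) mod int n = (j * (y - 1)) mod int n"
    using assms by (metis mod_diff_left_eq mod_mult_right_eq)
  then show ?thesis
    unfolding W_map_def by (metis zeta_cong zeta_minus)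
qed

lemma W_act_W_map: "W_act n j k (W_map n j x) = W_map n j (2 * k - x)"
  by (simp add: W_act_def W_map_def vec_eq_iff forall_2 algebra_simps flip: zeta_add)

lemma linear_W_act: "linear_on UNIV (W_act n j k)"
  by (simp add: linear_on_def W_act_def vec_eq_iff forall_2 scaleC_vec_def scaleC_complex_def algebra_simps)

text \<open>The condition on \<open>j\<close> says that the square of \<open>zeta n j\<close> is not
  1. This makes the vectors at 1 and 2, namely (1, 1) and (\<open>zeta n j\<close>, its inverse),
  independent.\<close>

lemma dihedral_action_W:
  assumes n: "n > 0" and j: "\<not> int n dvd 2 * j"
  shows "dihedral_action n (W_map n j) (W_act n j)"
proof
  let ?z = "zeta n j"
  have "?z * ?z \<noteq> 1"
    using j n zeta_eq_1_iff[OF n, of "2 * j"] zeta_add[of n j j] by simp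
  then have d: "?z - inverse ?z \<noteq> 0"
    by (auto simp: field_simps)
  have "v \<in> cvec.span (range (W_map n j))" for v
  proof -
    \<comment> \<open>The solution of v = \<alpha> (1, 1) + \<beta> (\<open>?z\<close>,
      \<open>inverse ?z\<close>); subtracting the coordinates isolates \<beta>.\<close>
    define \<beta> where "\<beta> = (v $ 1 - v $ 2) / (?z - inverse ?z)"
    define \<alpha> where "\<alpha> = v $ 1 - \<beta> * ?z"
    have \<beta>: "\<beta> * (?z - inverse ?z) = v $ 1 - v $ 2" using d by (simp add: \<beta>_def)
    have "v $ 1 = \<alpha> + \<beta> * ?z" "v $ 2 = \<alpha> + \<beta> * inverse ?z"
      using \<beta> by (simp_all add: \<alpha>_def right_diff_distrib) (simp add: algebra_simps)
    then have "v = \<alpha> *\<^sub>C W_map n j 1 + \<beta> *\<^sub>C W_map n j 2"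
      by (simp add: vec_eq_iff forall_2 W_map_def scaleC_vec_def scaleC_complex_def zeta_minus)
    then show ?thesis
      by (metis cvec.span_add cvec.span_base cvec.span_scale rangeI)
  qed
  then show "cvec.span (range (W_map n j)) = UNIV" by blast
qed (simp_all add: n W_act_W_map linear_W_act, erule W_map_cong)

lemma W_act_1: "W_act n j 1 = (\<lambda>v. (vector [vector [0, 1], vector [1, 0]] :: complex ^ 2 ^ 2) *v v)"
  by (simp add: fun_eq_iff W_act_def vec_eq_iff forall_2 matrix_vector_mult_def sum_2)

lemma W_act_2: "W_act n j 2 = (\<lambda>v. (vector [vector [0, zeta n (2 * j)],
    vector [inverse (zeta n (2 * j)), 0]] :: complex ^ 2 ^ 2) *v v)"
  by (simp add: fun_eq_iff W_act_def vec_eq_iff forall_2 matrix_vector_mult_def sum_2 zeta_minus)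

lemma W_act_cong:
  assumes "(2 * j) mod int n = (2 * j') mod int n"
  shows "W_act n j = W_act n j'"
proof -
  have "zeta n (2 * j * (k - 1)) = zeta n (2 * j' * (k - 1))" for k
    by (rule zeta_cong) (metis assms mod_mult_left_eq)
  then show ?thesis by (simp add: fun_eq_iff W_act_def zeta_minus)
qed

lemma W_rep_properties:
  assumes n: "n > 0" and j: "\<not> int n dvd 2 * j"
  shows W_rep_exists: "\<exists>A. is_W_rep n (zeta n (2 * j)) A"
    and quandle_rep_W_rep: "quandle_rep (dihedral n) (W_rep n (zeta n (2 * j)))"
    and rspace_W_rep: "rspace (W_rep n (zeta n (2 * j))) = UNIV"
    and ract_W_rep: "x \<in> {1..int n} \<Longrightarrow> ract (W_rep n (zeta n (2 * j))) x = W_act n j x"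
proof -
  interpret dihedral_action n "W_map n j" "W_act n j"
    by (rule dihedral_action_W[OF assms])
  let ?l = "zeta n (2 * j)"
  let ?B = "W_rep n ?l"
  show ex: "\<exists>A. is_W_rep n ?l A"
    using group_rep_exists unfolding is_W_rep_def W_act_1[of n j, symmetric] W_act_2[symmetric] by metis
  define A where "A = (SOME A. is_W_rep n ?l A)"
  have A: "is_W_rep n ?l A"
    unfolding A_def by (rule someI_ex[OF ex])
  have B: "?B = induced_rep (dihedral n) A" by (simp add: W_rep_def A_def)
  show sp: "rspace ?B = UNIV" using A by (simp add: B induced_rep_def is_W_rep_def)
  show act: "ract ?B x = W_act n j x" if "x \<in> {1..int n}" for x
    unfolding B
    by (rule induced_rep_determined) (use A that in \<open>auto simp: is_W_rep_def W_act_1 W_act_2\<close>)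
  show "quandle_rep (dihedral n) ?B"
    by (rule quandle_rep_dihedral[OF sp act])
qed

lemma equivariant_map_W_rep:
  assumes n: "n > 0" and j: "\<not> int n dvd 2 * j"
    and j': "(2 * j') mod int n = (2 * j) mod int n"
  shows "equivariant_map n (W_rep n (zeta n (2 * j))) (W_map n j')"
  by (rule equivariant_mapI[OF quandle_rep_imp_linear_action[OF quandle_rep_W_rep[OF n j]] _ W_map_cong])
    (simp_all add: rspace_W_rep[OF n j] ract_W_rep[OF n j] W_act_cong[OF j', symmetric] W_act_W_map)

text \<open>
  \<open>R\<^sub>1R\<^sub>2 = diag(\<lambda>\<^sup>-\<^sup>1, \<lambda>)\<close> has distinct eigenvalues as \<open>\<lambda>\<^sup>2 \<noteq> 1\<close>, so an invariant subspace contains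
  a coordinate axis if it is nonzero, and \<open>R\<^sub>1\<close> swaps the axes.
\<close>

lemma irreducible_W_rep:
  assumes n: "n > 0" and j: "\<not> int n dvd 4 * j"
  shows "irreducible_rep (dihedral n) (W_rep n (zeta n (2 * j)))"
  unfolding irreducible_rep_def
proof (intro conjI allI impI)
  have j2: "\<not> int n dvd 2 * j"
    using j dvd_mult[of "int n" "2 * j" 2] by auto
  let ?l = "zeta n (2 * j)"
  let ?B = "W_rep n ?l"
  show "quandle_rep (dihedral n) ?B" by (rule quandle_rep_W_rep[OF n j2])
  fix U assume U: "subrep (dihedral n) U ?B"
  then have sub: "cvec.subspace U" by (simp add: subrep_def)
  \<comment> \<open>Invariance is known for elements of the carrier, which therefore has to contain
    2.\<close>
  have "n \<noteq> 1"
  proof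
    assume "n = 1"
    then show False using j by simp
  qed
  then have R: "W_act n j k u \<in> U" if "u \<in> U" "k = 1 \<or> k = 2" for k u
  proof -
    have k: "k \<in> {1..int n}" using that(2) n \<open>n \<noteq> 1\<close> by auto
    then have "ract ?B k u \<in> U" using U that(1) unfolding subrep_def carrier_dihedral by blast
    then show ?thesis by (simp only: ract_W_rep[OF n j2 k])
  qed
  have "?l * ?l \<noteq> 1"
    using j zeta_eq_1_iff[OF n, of "4 * j"] zeta_add[of n "2 * j" "2 * j"] by simp
  then have d: "?l - inverse ?l \<noteq> 0"
    by (auto simp: field_simps)
  have axis: "vector [0, 1] \<in> U" if u: "u \<in> U" "u $ 2 \<noteq> 0" for u
  proof -
    \<comment> \<open>Subtracting the first eigenvalue of R_1 R_2 kills the first coordinate and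
      scales the second by \<open>?l - inverse ?l\<close>.\<close>
    have "W_act n j 1 (W_act n j 2 u) - inverse ?l *\<^sub>C u \<in> U"
      using u R by (intro cvec.subspace_diff cvec.subspace_scale sub) auto
    also have "W_act n j 1 (W_act n j 2 u) - inverse ?l *\<^sub>C u =
        ((?l - inverse ?l) * u $ 2) *\<^sub>C vector [0, 1]"
      by (simp add: vec_eq_iff forall_2 W_act_def scaleC_vec_def scaleC_complex_def
          zeta_minus left_diff_distrib)
    finally have "inverse ((?l - inverse ?l) * u $ 2) *\<^sub>C
        (((?l - inverse ?l) * u $ 2) *\<^sub>C vector [0, 1]) \<in> U"
      by (rule cvec.subspace_scale[OF sub])
    moreover have "inverse ((?l - inverse ?l) * u $ 2) * ((?l - inverse ?l) * u $ 2) = 1"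
      using d u(2) by (intro left_inverse) simp
    ultimately show ?thesis by (simp only: scaleC_scaleC scaleC_one)
  qed
  show "U = {0} \<or> U = rspace ?B"
  proof (cases "U = {0}")
    case False
    then obtain u where u: "u \<in> U" "u \<noteq> 0" using cvec.subspace_0[OF sub] by blast
    have e2: "vector [0, 1] \<in> U"
    proof (cases "u $ 2 = 0")
      case True
      then have "W_act n j 1 u $ 2 \<noteq> 0"
        using u(2) by (auto simp: W_act_def vec_eq_iff forall_2)
      then show ?thesis using axis R u(1) by blast
    qed (use axis u in blast)
    have "W_act n j 1 (vector [0, 1]) \<in> U" using R e2 by blast
    then have "v $ 1 *\<^sub>C W_act n j 1 (vector [0, 1]) + v $ 2 *\<^sub>C vector [0, 1] \<in> U" for v :: "complex ^ 2"
      using e2 by (intro cvec.subspace_add cvec.subspace_scale sub)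
    moreover have "v $ 1 *\<^sub>C W_act n j 1 (vector [0, 1]) + v $ 2 *\<^sub>C vector [0, 1] = v" for v :: "complex ^ 2"
      by (simp add: vec_eq_iff forall_2 W_act_def scaleC_vec_def scaleC_complex_def)
    ultimately have "U = UNIV" by auto
    then show ?thesis using rspace_W_rep[OF n j2] by simp
  qed simp
qed

section \<open>One-dimensional summands\<close>

text \<open>A reflection changes the exponent by a multiple of \<open>2 * j\<close>, hence of
  \<open>n\<close>. The action is written \<open>1 * z\<close> to match the shape
  \<open>\<kappa> k * z\<close> of \<open>char_rep_properties\<close>.\<close>

lemma dihedral_action_trivial:
  assumes n: "n > 0" and j: "int n dvd 2 * j"
  shows "dihedral_action n (\<lambda>x. zeta n (j * (x - 1))) (\<lambda>k z. 1 * z)"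
proof
  show "zeta n (j * (x - 1)) = zeta n (j * (y - 1))" if "x mod int n = y mod int n" for x y
    using W_map_cong[OF that, of j] by (simp add: W_map_def vec_eq_iff forall_2)
  show "1 * zeta n (j * (x - 1)) = zeta n (j * (2 * k - x - 1))" for k x
  proof -
    have "int n dvd 2 * j * (x - k)" using j by (rule dvd_mult2)
    then have "zeta n (j * (x - 1)) = zeta n (j * (2 * k - x - 1))"
      by (intro zeta_cong) (simp add: mod_eq_dvd_iff algebra_simps)
    then show ?thesis by simp
  qed
  have "z \<in> cvec.span (range (\<lambda>x. zeta n (j * (x - 1))))" for z
    using cvec.span_scale[OF cvec.span_base[OF rangeI[of "\<lambda>x. zeta n (j * (x - 1))" 1]], of z]
    by (simp add: scaleC_complex_def)
  then show "cvec.span (range (\<lambda>x. zeta n (j * (x - 1)))) = UNIV" by blast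
qed (use n in \<open>auto simp: linear_on_def\<close>)

text \<open>
  For \<open>n = 4q\<close>, the functionals \<open>v\<^sub>1 + \<epsilon> v\<^sub>2\<close>, \<open>\<epsilon> = \<plusminus>1\<close>, are semi-invariant on \<open>W(-1)\<close>; this one is
  applied to \<open>W_map n q x\<close>.
\<close>

definition sign_map :: "nat \<Rightarrow> complex \<Rightarrow> int \<Rightarrow> complex" where
  "sign_map q \<epsilon> x = zeta (4 * q) (int q * (x - 1)) + \<epsilon> * zeta (4 * q) (- (int q * (x - 1)))"

text \<open>With n = 4q the factor \<open>zeta (4 * q) (2 * int q * (k - 1))\<close> is (-1)^(k-1),
  so R_1 acts by \<epsilon> and R_2 by -\<epsilon>.\<close>

lemma dihedral_action_sign:
  assumes q: "q > 0" and \<epsilon>: "\<epsilon> = 1 \<or> \<epsilon> = - 1"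
  shows "dihedral_action (4 * q) (sign_map q \<epsilon>)
    (\<lambda>k z. \<epsilon> * zeta (4 * q) (2 * int q * (k - 1)) * z)" (is "dihedral_action ?n ?p ?a")
proof
  have n: "?n > 0" using q by simp
  show "?n > 0" by fact
  show "?p x = ?p y" if "x mod int ?n = y mod int ?n" for x y
    using W_map_cong[OF that, of "int q"] by (simp add: sign_map_def W_map_def vec_eq_iff forall_2)
  show "linear_on UNIV (?a k)" for k
    by (simp add: linear_on_def scaleC_complex_def algebra_simps)
  show "?a k (?p x) = ?p (2 * k - x)" for k x
  proof -
    let ?y = "int q * (x - 1)" and ?k = "2 * int q * (k - 1)"
    \<comment> \<open>The exponents differ by 4q(1 - k), a multiple of \<open>?n\<close>.\<close>
    have "zeta ?n (- ?k) = zeta ?n ?k"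
      by (rule zeta_cong, unfold mod_eq_dvd_iff, rule dvdI[of _ _ "1 - k"]) (simp add: algebra_simps)
    then have "zeta ?n (- (int q * (2 * k - x - 1))) = zeta ?n ?k * zeta ?n ?y"
      using zeta_add[of ?n "- ?k" ?y] by (simp add: algebra_simps)
    moreover have "zeta ?n (int q * (2 * k - x - 1)) = zeta ?n ?k * zeta ?n (- ?y)"
      by (simp add: algebra_simps flip: zeta_add)
    ultimately show ?thesis
      using \<epsilon> by (auto simp: sign_map_def algebra_simps)
  qed
  have "zeta ?n (int q) * zeta ?n (int q) \<noteq> 1"
    using q zeta_eq_1_iff[OF n, of "2 * int q"] zeta_add[of ?n "int q" "int q"]
    by (auto dest: zdvd_imp_le)
  \<comment> \<open>The value at 1 is 1 + \<epsilon>. It vanishes for \<epsilon> = -1, where the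
    value at 2 is \<open>zeta ?n (int q)\<close> minus its inverse.\<close>
  then have "?p 1 \<noteq> 0 \<or> ?p 2 \<noteq> 0"
    using \<epsilon> by (auto simp: sign_map_def zeta_minus field_simps)
  then obtain x where x: "?p x \<noteq> 0" by blast
  have "z \<in> cvec.span (range ?p)" for z
    using cvec.span_scale[OF cvec.span_base[OF rangeI[of ?p x]], of "z / ?p x"] x
    by (simp add: scaleC_complex_def)
  then show "cvec.span (range ?p) = UNIV" by blast
qed

lemma zeta_half: "q > 0 \<Longrightarrow> zeta (4 * q) (2 * int q) = - 1"
  by (simp add: zeta_def field_simps)

lemma sign_char_rep:
  assumes "q > 0" "\<epsilon> = 1 \<or> \<epsilon> = - 1"
  shows "\<exists>A. is_char_rep (4 * q) \<epsilon> (- \<epsilon>) A"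
    and "irreducible_rep (dihedral (4 * q)) (char_rep (4 * q) \<epsilon> (- \<epsilon>))"
    and "equivariant_map (4 * q) (char_rep (4 * q) \<epsilon> (- \<epsilon>)) (sign_map q \<epsilon>)"
  using char_rep_exists[OF dihedral_action_sign[OF assms]]
    irreducible_char_rep[OF dihedral_action_sign[OF assms]]
    equivariant_map_char_rep[OF dihedral_action_sign[OF assms]] zeta_half[OF assms(1)]
  by simp_all

lemma trivial_char_rep:
  assumes "n > 0"
  shows "\<exists>A. is_char_rep n 1 1 A" and "irreducible_rep (dihedral n) (char_rep n 1 1)"
  using char_rep_exists[OF dihedral_action_trivial[OF assms, of 0]]
    irreducible_char_rep[OF dihedral_action_trivial[OF assms, of 0]] by simp_all

lemma equivariant_map_trivial:
  assumes "n > 0" "int n dvd 2 * j"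
  shows "equivariant_map n (char_rep n 1 1) (\<lambda>x. zeta n (j * (x - 1)))"
  using equivariant_map_char_rep[OF dihedral_action_trivial[OF assms]] by simp

section \<open>The decomposition\<close>

lemma sum_scaleC_sign_map:
  "(\<Sum>x\<in>{1..int (4 * q)}. f x *\<^sub>C sign_map q \<epsilon> x) =
     dft (4 * q) f (int q) + \<epsilon> * dft (4 * q) f (- int q)"
  by (simp add: sign_map_def dft_def scaleC_complex_def ring_distribs sum.distrib sum_distrib_left mult_ac)

lemma sum_scaleC_Pair: "(\<Sum>x\<in>I. f x *\<^sub>C (p x, q x)) = (\<Sum>x\<in>I. f x *\<^sub>C p x, \<Sum>x\<in>I. f x *\<^sub>C q x)"
  by (simp add: scaleC_prod_def prod_eq_iff fst_sum snd_sum)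

lemma sum_scaleC_restrict:
  "finite I \<Longrightarrow> (\<Sum>x\<in>I. f x *\<^sub>C (\<lambda>s. if s \<in> S then p s x else 0)) =
     (\<lambda>s. if s \<in> S then \<Sum>x\<in>I. f x *\<^sub>C p s x else 0)"
  by (induction I rule: finite_induct) (auto simp: scaleC_fun_def fun_eq_iff)

lemma sum_scaleC_W_map: "(\<Sum>x\<in>{1..int n}. f x *\<^sub>C W_map n j x) = vector [dft n f j, dft n f (- j)]"
  by (simp add: vec_eq_iff forall_2 W_map_def scaleC_vec_def scaleC_complex_def dft_def)

lemma sum_scaleC_zeta: "(\<Sum>x\<in>{1..int n}. f x *\<^sub>C zeta n (j * (x - 1))) = dft n f j"
  by (simp add: dft_def scaleC_complex_def)

text \<open>Brings negative frequencies into \<open>{0..<int n}\<close>, where coefficients can be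
  prescribed.\<close>

lemma dft_minus: "dft n f (- j) = dft n f (int n - j)"
  by (rule dft_cong) simp

lemma vector_2_eq_iff: "(vector [a, b] :: 'a::zero ^ 2) = v \<longleftrightarrow> v $ 1 = a \<and> v $ 2 = b"
  by (auto simp: vec_eq_iff forall_2)

section \<open>The three residue cases\<close>

lemma regular_decomposition_odd:
  assumes n: "n = 2 * N + 1"
  shows "isomorphic_rep (dihedral n) (regular_rep (dihedral n))
    (char_rep n 1 1 \<boxplus> rep_Sum {1..N} (\<lambda>s. W_rep n (zeta n (2 * int s))))"
    (is "isomorphic_rep _ _ ?B")
proof -
  have pos: "n > 0" using n by simp
  have ndvd: "\<not> int n dvd 2 * int s" if s: "s \<in> {1..N}" for s
  proof -
    have "0 < 2 * int s" "2 * int s < int n" using s n by auto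
    then show ?thesis using zdvd_not_zless by blast
  qed
  define p where "p x = (zeta n (0 * (x - 1)), \<lambda>s. if s \<in> {1..N} then W_map n (int s) x else 0)" for x
  have p: "equivariant_map n ?B p"
    unfolding p_def
    by (intro equivariant_map_rep_sum equivariant_map_rep_Sum equivariant_map_trivial
        equivariant_map_W_rep pos ndvd refl) simp
  have sum: "(\<Sum>x\<in>{1..int n}. f x *\<^sub>C p x) = (dft n f 0,
      \<lambda>s. if s \<in> {1..N} then vector [dft n f (int s), dft n f (int n - int s)] else 0)" for f
    unfolding p_def
    by (simp only: sum_scaleC_Pair sum_scaleC_restrict[OF finite_atLeastAtMost_int] sum_scaleC_zeta
        sum_scaleC_W_map dft_minus)
  show ?thesis
  proof (rule regular_dihedral_isomorphic[OF pos p])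
    fix f k assume f: "(\<Sum>x\<in>{1..int n}. f x *\<^sub>C p x) = 0" and k: "k \<in> {0..<int n}"
    have 0: "dft n f 0 = 0" using f unfolding sum by (simp add: prod_eq_iff)
    have W: "dft n f (int s) = 0 \<and> dft n f (int n - int s) = 0" if "s \<in> {1..N}" for s
      using f that unfolding sum by (simp add: prod_eq_iff fun_eq_iff vector_2_eq_iff split: if_splits)
    have "k = 0 \<or> nat k \<in> {1..N} \<or> nat (int n - k) \<in> {1..N}"
      using k n by auto
    then consider "k = 0" | "nat k \<in> {1..N}" | "nat (int n - k) \<in> {1..N}" by blast
    then show "dft n f k = 0"
      using 0 W[of "nat k"] W[of "nat (int n - k)"] k by cases (auto split: if_splits)
  next
    fix w assume w: "w \<in> rspace ?B"
    \<comment> \<open>The coefficients that \<open>sum\<close> forces: second coordinates of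
      \<open>snd w s\<close> sit at frequency \<open>int n - int s\<close>.\<close>
    define c where "c k = (if k = 0 then fst w else if k \<le> int N then snd w (nat k) $ 1
      else snd w (nat (int n - k)) $ 2)" for k
    show "\<exists>c. \<forall>f. (\<forall>k\<in>{0..<int n}. dft n f k = c k) \<longrightarrow> (\<Sum>x\<in>{1..int n}. f x *\<^sub>C p x) = w"
    proof (intro exI[of _ c] allI impI)
      fix f assume "\<forall>k\<in>{0..<int n}. dft n f k = c k"
      then have d: "dft n f k = c k" if "0 \<le> k" "k < int n" for k using that by simp
      have "snd w s = 0" if "s \<notin> {1..N}" for s using w that by (auto simp: rspace_rep_Sum)
      moreover have "dft n f 0 = fst w" using pos by (simp add: d c_def)
      moreover have "dft n f (int s) = snd w s $ 1" "dft n f (int n - int s) = snd w s $ 2"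
        if "s \<in> {1..N}" for s
      proof -
        have "0 < s" "s \<le> N" "int n = 2 * int N + 1" using that n by auto
        then show "dft n f (int s) = snd w s $ 1" "dft n f (int n - int s) = snd w s $ 2"
          by (simp_all add: d c_def)
      qed
      ultimately show "(\<Sum>x\<in>{1..int n}. f x *\<^sub>C p x) = w"
        unfolding sum by (simp add: prod_eq_iff fun_eq_iff vector_2_eq_iff)
    qed
  qed
qed

text \<open>For n = 2m with m = 2N + 1, the frequencies other than 0 and m form four blocks of
  length N: s up to N, m - s from N + 1 to m - 1, m + s up to m + N, and n - s from n - N
  on.\<close>

lemma regular_decomposition_2_mod_4:
  assumes n: "n = 4 * N + 2"
  shows "isomorphic_rep (dihedral n) (regular_rep (dihedral n))
    ((char_rep n 1 1 \<boxplus> char_rep n 1 1) \<boxplus>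
      rep_Sum {1..N} (\<lambda>s. W_rep n (zeta n (2 * int s)) \<boxplus> W_rep n (zeta n (2 * int s))))"
    (is "isomorphic_rep _ _ ?B")
proof -
  define m where "m = 2 * int N + 1"
  have m: "int n = 2 * m" using n by (simp add: m_def)
  have pos: "n > 0" using n by simp
  have ndvd: "\<not> int n dvd 2 * int s" if s: "s \<in> {1..N}" for s
  proof -
    have "0 < 2 * int s" "2 * int s < int n" using s n by auto
    then show ?thesis using zdvd_not_zless by blast
  qed
  have shift: "(2 * (m + int s)) mod int n = (2 * int s) mod int n" for s
    by (simp add: m ring_distribs)
  define p where "p x = ((zeta n (0 * (x - 1)), zeta n (m * (x - 1))),
    \<lambda>s. if s \<in> {1..N} then (W_map n (int s) x, W_map n (m + int s) x) else 0)" for x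
  have p: "equivariant_map n ?B p"
    unfolding p_def
    by (intro equivariant_map_rep_sum equivariant_map_rep_Sum equivariant_map_trivial
        equivariant_map_W_rep pos ndvd refl shift) (simp_all add: m)
  have sum: "(\<Sum>x\<in>{1..int n}. f x *\<^sub>C p x) = ((dft n f 0, dft n f m), \<lambda>s. if s \<in> {1..N}
      then (vector [dft n f (int s), dft n f (int n - int s)],
        vector [dft n f (m + int s), dft n f (m - int s)]) else 0)" for f
  proof -
    \<comment> \<open>The partner of m + s, brought into range.\<close>
    have "int n - (m + int s) = m - int s" for s using m by simp
    then show ?thesis
      unfolding p_def
      by (simp only: sum_scaleC_Pair sum_scaleC_restrict[OF finite_atLeastAtMost_int] sum_scaleC_zeta
        sum_scaleC_W_map dft_minus)
  qed
  show ?thesis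
  proof (rule regular_dihedral_isomorphic[OF pos p])
    fix f k assume f: "(\<Sum>x\<in>{1..int n}. f x *\<^sub>C p x) = 0" and k: "k \<in> {0..<int n}"
    have 0: "dft n f 0 = 0" "dft n f m = 0" using f unfolding sum by (simp_all add: prod_eq_iff)
    have W: "dft n f (int s) = 0" "dft n f (int n - int s) = 0"
      "dft n f (m + int s) = 0" "dft n f (m - int s) = 0" if "s \<in> {1..N}" for s
      using f that unfolding sum
      by (simp_all add: prod_eq_iff fun_eq_iff vector_2_eq_iff split: if_splits)
    have "k = 0 \<or> k = m \<or> nat k \<in> {1..N} \<or> nat (int n - k) \<in> {1..N} \<or>
        nat (k - m) \<in> {1..N} \<or> nat (m - k) \<in> {1..N}"
      using k m m_def by auto
    then consider "k = 0" | "k = m" | "nat k \<in> {1..N}" | "nat (int n - k) \<in> {1..N}"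
      | "nat (k - m) \<in> {1..N}" | "nat (m - k) \<in> {1..N}" by blast
    then show "dft n f k = 0"
      using 0 W(1)[of "nat k"] W(2)[of "nat (int n - k)"] W(3)[of "nat (k - m)"]
        W(4)[of "nat (m - k)"] k by cases (auto split: if_splits)
  next
    fix w assume w: "w \<in> rspace ?B"
    define c where "c k = (if k = 0 then fst (fst w) else if k = m then snd (fst w)
      else if k \<le> int N then fst (snd w (nat k)) $ 1
      else if k \<ge> int n - int N then fst (snd w (nat (int n - k))) $ 2
      else if k > m then snd (snd w (nat (k - m))) $ 1
      else snd (snd w (nat (m - k))) $ 2)" for k
    show "\<exists>c. \<forall>f. (\<forall>k\<in>{0..<int n}. dft n f k = c k) \<longrightarrow> (\<Sum>x\<in>{1..int n}. f x *\<^sub>C p x) = w"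
    proof (intro exI[of _ c] allI impI)
      fix f assume "\<forall>k\<in>{0..<int n}. dft n f k = c k"
      then have d: "dft n f k = c k" if "0 \<le> k" "k < int n" for k using that by simp
      have "snd w s = 0" if "s \<notin> {1..N}" for s using w that by (auto simp: rspace_rep_Sum)
      moreover have "dft n f 0 = fst (fst w)" "dft n f m = snd (fst w)"
        using m m_def by (simp_all add: d c_def)
      moreover have "dft n f (int s) = fst (snd w s) $ 1" "dft n f (int n - int s) = fst (snd w s) $ 2"
        "dft n f (m + int s) = snd (snd w s) $ 1" "dft n f (m - int s) = snd (snd w s) $ 2"
        if "s \<in> {1..N}" for s
      proof -
        have "0 < s" "s \<le> N" using that by auto
        then show "dft n f (int s) = fst (snd w s) $ 1" "dft n f (int n - int s) = fst (snd w s) $ 2"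
          "dft n f (m + int s) = snd (snd w s) $ 1" "dft n f (m - int s) = snd (snd w s) $ 2"
          using m m_def by (simp_all add: d c_def)
      qed
      ultimately show "(\<Sum>x\<in>{1..int n}. f x *\<^sub>C p x) = w"
        unfolding sum by (simp add: prod_eq_iff fun_eq_iff vector_2_eq_iff)
    qed
  qed
qed

text \<open>With n = 4q and m = 2q the four blocks have length q - 1 and are separated by 0, q, m
  and n - q. The pair q, n - q would belong to W(-1) and feeds the two sign characters
  instead.\<close>

lemma regular_decomposition_0_mod_4:
  assumes n: "n = 4 * q" and q: "q > 0"
  shows "isomorphic_rep (dihedral n) (regular_rep (dihedral n))
    ((char_rep n 1 1 \<boxplus> char_rep n 1 1) \<boxplus> char_rep n 1 (- 1) \<boxplus> char_rep n (- 1) 1 \<boxplus>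
      rep_Sum {1..q - 1} (\<lambda>s. W_rep n (zeta n (2 * int s)) \<boxplus> W_rep n (zeta n (2 * int s))))"
    (is "isomorphic_rep _ _ ?B")
proof -
  define m where "m = 2 * int q"
  have m: "int n = 2 * m" using n by (simp add: m_def)
  have pos: "n > 0" using n q by simp
  have ndvd: "\<not> int n dvd 2 * int s" if s: "s \<in> {1..q - 1}" for s
  proof -
    have "0 < 2 * int s" "2 * int s < int n" using s n by auto
    then show ?thesis using zdvd_not_zless by blast
  qed
  have shift: "(2 * (m + int s)) mod int n = (2 * int s) mod int n" for s
    by (simp add: m ring_distribs)
  have sign: "equivariant_map n (char_rep n 1 (- 1)) (sign_map q 1)"
    "equivariant_map n (char_rep n (- 1) 1) (sign_map q (- 1))"
    using sign_char_rep(3)[OF q, of 1] sign_char_rep(3)[OF q, of "- 1"] n by simp_all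
  define p where "p x = ((zeta n (0 * (x - 1)), zeta n (m * (x - 1))), sign_map q 1 x, sign_map q (- 1) x,
    \<lambda>s. if s \<in> {1..q - 1} then (W_map n (int s) x, W_map n (m + int s) x) else 0)" for x
  have p: "equivariant_map n ?B p"
    unfolding p_def
    by (intro equivariant_map_rep_sum equivariant_map_rep_Sum equivariant_map_trivial sign
        equivariant_map_W_rep pos ndvd refl shift) (simp_all add: m)
  have sum: "(\<Sum>x\<in>{1..int n}. f x *\<^sub>C p x) = ((dft n f 0, dft n f m),
      dft n f (int q) + dft n f (int n - int q), dft n f (int q) - dft n f (int n - int q),
      \<lambda>s. if s \<in> {1..q - 1} then (vector [dft n f (int s), dft n f (int n - int s)],
        vector [dft n f (m + int s), dft n f (m - int s)]) else 0)" for f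
  proof -
    have "int n - (m + int s) = m - int s" for s using m by simp
    moreover have "(\<Sum>x\<in>{1..int n}. f x *\<^sub>C sign_map q 1 x) = dft n f (int q) + dft n f (int n - int q)"
      "(\<Sum>x\<in>{1..int n}. f x *\<^sub>C sign_map q (- 1) x) = dft n f (int q) - dft n f (int n - int q)"
      using sum_scaleC_sign_map[of f q] by (simp_all add: dft_minus flip: n)
    ultimately show ?thesis
      unfolding p_def
      by (simp only: sum_scaleC_Pair sum_scaleC_restrict[OF finite_atLeastAtMost_int] sum_scaleC_zeta
        sum_scaleC_W_map dft_minus)
  qed
  show ?thesis
  proof (rule regular_dihedral_isomorphic[OF pos p])
    fix f k assume f: "(\<Sum>x\<in>{1..int n}. f x *\<^sub>C p x) = 0" and k: "k \<in> {0..<int n}"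
    have 0: "dft n f 0 = 0" "dft n f m = 0" using f unfolding sum by (simp_all add: prod_eq_iff)
    have "dft n f (int q) + dft n f (int n - int q) = 0" "dft n f (int q) - dft n f (int n - int q) = 0"
      using arg_cong[OF f[unfolded sum], of "\<lambda>w. fst (snd w)"]
        arg_cong[OF f[unfolded sum], of "\<lambda>w. fst (snd (snd w))"] by simp_all
    then have q0: "dft n f (int q) = 0" "dft n f (int n - int q) = 0" by (simp_all add: add_eq_0_iff)
    have W: "dft n f (int s) = 0" "dft n f (int n - int s) = 0"
      "dft n f (m + int s) = 0" "dft n f (m - int s) = 0" if "s \<in> {1..q - 1}" for s
      using f that unfolding sum
      by (simp_all add: prod_eq_iff fun_eq_iff vector_2_eq_iff split: if_splits)
    have "k = 0 \<or> k = m \<or> k = int q \<or> k = int n - int q \<or> (0 < k \<and> k < int q) \<or>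
        int n - int q < k \<or> (m < k \<and> k < int n - int q) \<or> (int q < k \<and> k < m)"
      using k by auto
    then consider "k = 0 \<or> k = m \<or> k = int q \<or> k = int n - int q" | "nat k \<in> {1..q - 1}"
      | "nat (int n - k) \<in> {1..q - 1}" | "nat (k - m) \<in> {1..q - 1}" | "nat (m - k) \<in> {1..q - 1}"
    proof (elim disjE)
      assume "int n - int q < k"
      then have "nat (int n - k) \<in> {1..q - 1}" using k by auto
      then show ?thesis using that by blast
    next
      assume "m < k \<and> k < int n - int q"
      then have "nat (k - m) \<in> {1..q - 1}" using m m_def by auto
      then show ?thesis using that by blast
    next
      assume "int q < k \<and> k < m"
      then have "nat (m - k) \<in> {1..q - 1}" using m m_def by auto
      then show ?thesis using that by blast
    next
      assume "0 < k \<and> k < int q"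
      then have "nat k \<in> {1..q - 1}" by auto
      then show ?thesis using that by blast
    qed (use that in blast)+
    then show "dft n f k = 0"
      using 0 q0 W(1)[of "nat k"] W(2)[of "nat (int n - k)"] W(3)[of "nat (k - m)"]
        W(4)[of "nat (m - k)"] k by cases (auto split: if_splits)
  next
    fix w assume w: "w \<in> rspace ?B"
    let ?u = "fst (snd w)" and ?v = "fst (snd (snd w))" and ?W = "snd (snd (snd w))"
    \<comment> \<open>The sign characters see the sum \<open>?u\<close> and the difference
      \<open>?v\<close> of the coefficients at q and n - q; the halves undo this.\<close>
    define c where "c k = (if k = 0 then fst (fst w) else if k = m then snd (fst w)
      else if k = int q then (?u + ?v) / 2 else if k = int n - int q then (?u - ?v) / 2
      else if k < int q then fst (?W (nat k)) $ 1
      else if k > int n - int q then fst (?W (nat (int n - k))) $ 2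
      else if k > m then snd (?W (nat (k - m))) $ 1
      else snd (?W (nat (m - k))) $ 2)" for k
    show "\<exists>c. \<forall>f. (\<forall>k\<in>{0..<int n}. dft n f k = c k) \<longrightarrow> (\<Sum>x\<in>{1..int n}. f x *\<^sub>C p x) = w"
    proof (intro exI[of _ c] allI impI)
      fix f assume "\<forall>k\<in>{0..<int n}. dft n f k = c k"
      then have d: "dft n f k = c k" if "0 \<le> k" "k < int n" for k using that by simp
      have "?W s = 0" if "s \<notin> {1..q - 1}" for s using w that by (auto simp: rspace_rep_Sum)
      moreover have "dft n f 0 = fst (fst w)" "dft n f m = snd (fst w)"
        using m m_def q by (simp_all add: d c_def)
      moreover have "dft n f (int q) = (?u + ?v) / 2" "dft n f (int n - int q) = (?u - ?v) / 2"
        using m m_def q by (simp_all add: d c_def)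
      moreover from this have "dft n f (int q) + dft n f (int n - int q) = ?u"
        "dft n f (int q) - dft n f (int n - int q) = ?v"
        by (simp_all only: add_divide_distrib[symmetric] diff_divide_distrib[symmetric]) simp_all
      moreover have "dft n f (int s) = fst (?W s) $ 1" "dft n f (int n - int s) = fst (?W s) $ 2"
        "dft n f (m + int s) = snd (?W s) $ 1" "dft n f (m - int s) = snd (?W s) $ 2"
        if "s \<in> {1..q - 1}" for s
      proof -
        have "0 < s" "s < q" using that by auto
        then show "dft n f (int s) = fst (?W s) $ 1" "dft n f (int n - int s) = fst (?W s) $ 2"
          "dft n f (m + int s) = snd (?W s) $ 1" "dft n f (m - int s) = snd (?W s) $ 2"
          using m m_def by (simp_all add: d c_def)
      qed
      ultimately show "(\<Sum>x\<in>{1..int n}. f x *\<^sub>C p x) = w"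
        unfolding sum by (simp add: prod_eq_iff fun_eq_iff vector_2_eq_iff)
    qed
  qed
qed

lemma W_rep_irreducible:
  assumes n: "n > 0" and j: "\<not> int n dvd 4 * j"
  shows "(\<exists>A. is_W_rep n (zeta n (2 * j)) A) \<and> irreducible_rep (dihedral n) (W_rep n (zeta n (2 * j)))"
proof -
  have "\<not> int n dvd 2 * j"
    using j dvd_mult[of "int n" "2 * j" 2] by auto
  then show ?thesis using W_rep_exists irreducible_W_rep assms by blast
qed

text \<open>Serves the even cases, where the range of \<open>s\<close> keeps \<open>4 * s\<close>
  below \<open>n\<close>; this gives \<lambda>^2 different from 1 for the parameter \<lambda> of
  W.\<close>

lemma not_dvd_4_mult:
  assumes "0 < s" "4 * s < n"
  shows "\<not> int n dvd 4 * int s"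
  using assms zdvd_not_zless[of "4 * int s" "int n"] by auto

theorem theorem5p1:
  fixes n :: nat
  assumes "n > 0"
  shows
   "(n mod 4 = 0 \<longrightarrow>
      (\<exists>A. is_char_rep n 1 1 A) \<and> irreducible_rep (dihedral n) (char_rep n 1 1) \<and>
      (\<exists>A. is_char_rep n 1 (-1) A) \<and> irreducible_rep (dihedral n) (char_rep n 1 (-1)) \<and>
      (\<exists>A. is_char_rep n (-1) 1 A) \<and> irreducible_rep (dihedral n) (char_rep n (-1) 1) \<and>
      (\<forall>s\<in>{1..n div 4 - 1}.
         (\<exists>A. is_W_rep n (root_unity (n div 2) ^ s) A) \<and>
         irreducible_rep (dihedral n) (W_rep n (root_unity (n div 2) ^ s))) \<and>
      isomorphic_rep (dihedral n) (regular_rep (dihedral n))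
        ((char_rep n 1 1 \<boxplus> char_rep n 1 1) \<boxplus> char_rep n 1 (-1) \<boxplus> char_rep n (-1) 1 \<boxplus>
         rep_Sum {1..n div 4 - 1} (\<lambda>s.
            W_rep n (root_unity (n div 2) ^ s) \<boxplus> W_rep n (root_unity (n div 2) ^ s)))) \<and>
    (n mod 4 = 2 \<longrightarrow>
      (\<exists>A. is_char_rep n 1 1 A) \<and> irreducible_rep (dihedral n) (char_rep n 1 1) \<and>
      (\<forall>s\<in>{1..(n - 2) div 4}.
         (\<exists>A. is_W_rep n (root_unity (n div 2) ^ s) A) \<and>
         irreducible_rep (dihedral n) (W_rep n (root_unity (n div 2) ^ s))) \<and>
      isomorphic_rep (dihedral n) (regular_rep (dihedral n))
        ((char_rep n 1 1 \<boxplus> char_rep n 1 1) \<boxplus>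
         rep_Sum {1..(n - 2) div 4} (\<lambda>s.
            W_rep n (root_unity (n div 2) ^ s) \<boxplus> W_rep n (root_unity (n div 2) ^ s)))) \<and>
    (odd n \<longrightarrow>
      (\<exists>A. is_char_rep n 1 1 A) \<and> irreducible_rep (dihedral n) (char_rep n 1 1) \<and>
      (\<forall>s\<in>{1..(n - 1) div 2}.
         (\<exists>A. is_W_rep n (root_unity n ^ (2 * s)) A) \<and>
         irreducible_rep (dihedral n) (W_rep n (root_unity n ^ (2 * s)))) \<and>
      isomorphic_rep (dihedral n) (regular_rep (dihedral n))
        (char_rep n 1 1 \<boxplus> rep_Sum {1..(n - 1) div 2} (\<lambda>s. W_rep n (root_unity n ^ (2 * s)))))"
proof (intro conjI impI)
  assume n4: "n mod 4 = 0"
  define q where "q = n div 4"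
  have n: "n = 4 * q" "q > 0" using n4 assms by (auto simp: q_def)
  have root: "root_unity (n div 2) ^ s = zeta n (2 * int s)" for s
    using zeta_double[of "2 * q" "int s"] n by (simp add: root_unity_power)
  show "\<exists>A. is_char_rep n 1 1 A" "irreducible_rep (dihedral n) (char_rep n 1 1)"
    by (rule trivial_char_rep[OF assms])+
  show "\<exists>A. is_char_rep n 1 (-1) A" "irreducible_rep (dihedral n) (char_rep n 1 (-1))"
    "\<exists>A. is_char_rep n (-1) 1 A" "irreducible_rep (dihedral n) (char_rep n (-1) 1)"
    using sign_char_rep(1,2)[OF n(2), of 1] sign_char_rep(1,2)[OF n(2), of "- 1"] n(1) by simp_all
  show "\<forall>s\<in>{1..n div 4 - 1}. (\<exists>A. is_W_rep n (root_unity (n div 2) ^ s) A) \<and>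
      irreducible_rep (dihedral n) (W_rep n (root_unity (n div 2) ^ s))"
    unfolding root using n by (intro ballI W_rep_irreducible not_dvd_4_mult) auto
  show "isomorphic_rep (dihedral n) (regular_rep (dihedral n))
      ((char_rep n 1 1 \<boxplus> char_rep n 1 1) \<boxplus> char_rep n 1 (-1) \<boxplus> char_rep n (-1) 1 \<boxplus>
       rep_Sum {1..n div 4 - 1} (\<lambda>s.
          W_rep n (root_unity (n div 2) ^ s) \<boxplus> W_rep n (root_unity (n div 2) ^ s)))"
    unfolding root q_def[symmetric] by (rule regular_decomposition_0_mod_4[OF n])
next
  assume n4: "n mod 4 = 2"
  define N where "N = (n - 2) div 4"
  have n: "n = 4 * N + 2" using n4 unfolding N_def by presburger
  have root: "root_unity (n div 2) ^ s = zeta n (2 * int s)" for s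
    using zeta_double[of "2 * N + 1" "int s"] n by (simp add: root_unity_power)
  show "\<exists>A. is_char_rep n 1 1 A" "irreducible_rep (dihedral n) (char_rep n 1 1)"
    by (rule trivial_char_rep[OF assms])+
  show "\<forall>s\<in>{1..(n - 2) div 4}. (\<exists>A. is_W_rep n (root_unity (n div 2) ^ s) A) \<and>
      irreducible_rep (dihedral n) (W_rep n (root_unity (n div 2) ^ s))"
    unfolding root using n by (intro ballI W_rep_irreducible not_dvd_4_mult) auto
  show "isomorphic_rep (dihedral n) (regular_rep (dihedral n))
      ((char_rep n 1 1 \<boxplus> char_rep n 1 1) \<boxplus>
       rep_Sum {1..(n - 2) div 4} (\<lambda>s.
          W_rep n (root_unity (n div 2) ^ s) \<boxplus> W_rep n (root_unity (n div 2) ^ s)))"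
    unfolding root N_def[symmetric] by (rule regular_decomposition_2_mod_4[OF n])
next
  assume odd: "odd n"
  define N where "N = (n - 1) div 2"
  have n: "n = 2 * N + 1" using odd unfolding N_def by presburger
  have root: "root_unity n ^ (2 * s) = zeta n (2 * int s)" for s
    by (simp add: root_unity_power)
  show "\<exists>A. is_char_rep n 1 1 A" "irreducible_rep (dihedral n) (char_rep n 1 1)"
    by (rule trivial_char_rep[OF assms])+
  show "\<forall>s\<in>{1..(n - 1) div 2}. (\<exists>A. is_W_rep n (root_unity n ^ (2 * s)) A) \<and>
      irreducible_rep (dihedral n) (W_rep n (root_unity n ^ (2 * s)))"
    unfolding root N_def[symmetric]
  proof (intro ballI W_rep_irreducible)
    fix s assume s: "s \<in> {1..N}"
    \<comment> \<open>Here \<open>4 * s\<close> may exceed \<open>n\<close>, but \<open>n\<close> is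
      odd, so the factor 4 can be cancelled.\<close>
    then have "\<not> int n dvd int s" using n zdvd_not_zless[of "int s" "int n"] by auto
    moreover have "coprime (int n) (2 * 2)"
      using odd by (simp only: coprime_mult_right_iff) simp
    then have "coprime (int n) 4" by simp
    ultimately show "\<not> int n dvd 4 * int s" by (simp add: coprime_dvd_mult_right_iff)
  qed (rule assms)
  show "isomorphic_rep (dihedral n) (regular_rep (dihedral n))
      (char_rep n 1 1 \<boxplus> rep_Sum {1..(n - 1) div 2} (\<lambda>s. W_rep n (root_unity n ^ (2 * s))))"
    unfolding root N_def[symmetric] by (rule regular_decomposition_odd[OF n])
qed

end
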